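(* Fix $m\ge2$ and let $\mathcal X_m$ be the set of row sequences $(\rho^{(m)}|\cdots|\rho^{(1)})$ of $m$ strictly increasing (possibly empty) words of positive integers whose concatenation $\rho^{(m)}\cdots\rho^{(1)}$ is a reduced word. For each $1\le i<m$, the map $\mathrm{drop}_i$ is well defined as a map $\mathcal X_m\to\mathcal X_m$, and these maps satisfy: (i) $\mathrm{drop}_i\circ\mathrm{drop}_i=\mathrm{drop}_i$; (ii) $\mathrm{drop}_i\circ\mathrm{drop}_j=\mathrm{drop}_j\circ\mathrm{drop}_i$ whenever $|i-j|>1$; (iii) $\mathrm{drop}_i\circ\mathrm{drop}_{i+1}\circ\mathrm{drop}_i=\mathrm{drop}_{i+1}\circ\mathrm{drop}_i\circ\mathrm{drop}_{i+1}$ whenever $1\le i<i+1<m$.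
   Context: Reduced words: a word $(\rho_\ell,\ldots,\rho_1)$ of positive integers ($\rho_\ell$ leftmost) is reduced if $s_{\rho_\ell}\cdots s_{\rho_1}$ is a permutation with exactly $\ell$ inversions ($s_i=(i\ i{+}1)$). In a row sequence $(\rho^{(m)}|\cdots|\rho^{(1)})$, $\rho^{(1)}$ is regarded as the bottom row. Drop. Increasing words are written left to right, $\tau=\tau_1\cdots\tau_t$ with $\tau_1<\cdots<\tau_t$, $\sigma=\sigma_1\cdots\sigma_s$. The drop alignment of $\sigma$ below $\tau$: if $\tau_j>\sigma_j$ for all $j\le\min(s,t)$, $\sigma_j$ is placed in column $j$; otherwise, with $j_1$ least such that $\tau_{j_1}\le\sigma_{j_1}$, $\sigma_1..\sigma_{j_1-1}$ go to columns $1..j_1-1$, column $j_1$ gets no letter of $\sigma$, and $\sigma_{j_1}\cdots\sigma_s$ is aligned recursively below $\tau_{j_1+1}\cdots\tau_t$ (in columns $j_1+1,\dots$). Let $x_1,\dots,x_k$ be, left to right, the letters of $\tau$ with nothing below; factor $\tau=\tau^{(0)}x_1\tau^{(1)}\cdots x_k\tau^{(k)}$ and $\sigma=\sigma^{(0)}\cdots\sigma^{(k)}\sigma^{(k+1)}$ with $\sigma^{(j)}$ directly below $\tau^{(j)}$ ($0\le j\le k$) and $\sigma^{(k+1)}$ the letters right of column $t$. For $\tau\sigma$ reduced, $\mathrm{drop}(\tau\sigma)$ is the pair (top row, bottom row) $=(\tau^{(0)}\tau^{(1)}\cdots\tau^{(k)},\ \sigma^{(0)}x_1\hat\sigma^{(1)}\cdots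 x_k\hat\sigma^{(k)}\sigma^{(k+1)})$, where $\hat\sigma^{(j)}_i=\sigma^{(j)}_i+1$ for $i\le b_j$ and $\hat\sigma^{(j)}_i=\sigma^{(j)}_i$ otherwise, with $b_j=\max\{b\ge0:\tau^{(j)}_i=\sigma^{(j)}_1+i\ \forall\,1\le i\le b\}$ if $x_j=\tau^{(j)}_1-1$ and $b_j=0$ otherwise. $\mathrm{drop}_i$ replaces the two rows $(\rho^{(i+1)},\rho^{(i)})$ of a row sequence by the (top, bottom) pair $\mathrm{drop}(\rho^{(i+1)}\rho^{(i)})$ (with $\tau=\rho^{(i+1)}$, $\sigma=\rho^{(i)}$), leaving other rows unchanged. *)

theory Defs
  imports Main "HOL-Combinatorics.Transposition" "HOL-Library.FuncSet"
begin

text \<open>Words are lists in written order, leftmost letter first.\<close>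

definition word_perm :: "nat list \<Rightarrow> nat \<Rightarrow> nat" where
  "word_perm w = foldr (\<lambda>r p. transpose r (Suc r) \<circ> p) w id"

definition inversions :: "(nat \<Rightarrow> nat) \<Rightarrow> (nat \<times> nat) set" where
  "inversions p = {(a, b). 1 \<le> a \<and> a < b \<and> p b < p a}"

definition reduced_word :: "nat list \<Rightarrow> bool" where
  "reduced_word w \<longleftrightarrow> (\<forall>r\<in>set w. 1 \<le> r) \<and> card (inversions (word_perm w)) = length w"

text \<open>Columns and list positions are numbered from 0, so column \<open>c\<close> here is column \<open>c + 1\<close> in
  the usual numbering. The \<open>i\<close>-th entry of \<open>align_cols \<tau> \<sigma>\<close> is the column of the \<open>i\<close>-th letter of
  \<open>\<sigma>\<close> in the drop alignment of \<open>\<sigma>\<close> below \<open>\<tau>\<close>; the letters of \<open>\<tau>\<close> occupy the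
  columns \<open>0, \<dots>, length \<tau> - 1\<close>.\<close>

function align_cols :: "nat list \<Rightarrow> nat list \<Rightarrow> nat list" where
  "align_cols \<tau> \<sigma> =
    (if \<forall>j < min (length \<sigma>) (length \<tau>). \<tau> ! j > \<sigma> ! j then [0..<length \<sigma>]
     else (let j1 = (LEAST j. j < min (length \<sigma>) (length \<tau>) \<and> \<tau> ! j \<le> \<sigma> ! j)
           in [0..<j1] @ map (\<lambda>c. c + (j1 + 1)) (align_cols (drop (j1 + 1) \<tau>) (drop j1 \<sigma>))))"
  by pat_completeness auto
termination
  by (relation "measure (\<lambda>(\<tau>, \<sigma>). length \<tau>)") auto

declare align_cols.simps [simp del]

text \<open>The columns of the letters \<open>x\<^sub>1, \<dots>, x\<^sub>k\<close> of \<open>\<tau>\<close> with nothing below, left to right;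
  \<open>x\<^sub>j\<close> is in column \<open>gaps \<tau> \<sigma> ! (j - 1)\<close>.\<close>

definition gaps :: "nat list \<Rightarrow> nat list \<Rightarrow> nat list" where
  "gaps \<tau> \<sigma> = filter (\<lambda>c. c \<notin> set (align_cols \<tau> \<sigma>)) [0..<length \<tau>]"

definition gap_letter :: "nat list \<Rightarrow> nat list \<Rightarrow> nat \<Rightarrow> nat" where
  "gap_letter \<tau> \<sigma> j = \<tau> ! (gaps \<tau> \<sigma> ! (j - 1))"

text \<open>For \<open>0 \<le> j \<le> k\<close>, the factors \<open>\<tau>\<^sup>(\<^sup>j\<^sup>)\<close> and \<open>\<sigma>\<^sup>(\<^sup>j\<^sup>)\<close> lie in the columns \<open>c\<close> with
  \<open>block_start \<tau> \<sigma> j \<le> c < block_end \<tau> \<sigma> j\<close>.\<close>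

definition block_start :: "nat list \<Rightarrow> nat list \<Rightarrow> nat \<Rightarrow> nat" where
  "block_start \<tau> \<sigma> j = (if j = 0 then 0 else gaps \<tau> \<sigma> ! (j - 1) + 1)"

definition block_end :: "nat list \<Rightarrow> nat list \<Rightarrow> nat \<Rightarrow> nat" where
  "block_end \<tau> \<sigma> j = (if j < length (gaps \<tau> \<sigma>) then gaps \<tau> \<sigma> ! j else length \<tau>)"

definition top_block :: "nat list \<Rightarrow> nat list \<Rightarrow> nat \<Rightarrow> nat list" where
  "top_block \<tau> \<sigma> j = map (\<lambda>c. \<tau> ! c) [block_start \<tau> \<sigma> j..<block_end \<tau> \<sigma> j]"

definition bottom_block :: "nat list \<Rightarrow> nat list \<Rightarrow> nat \<Rightarrow> nat list" where
  "bottom_block \<tau> \<sigma> j =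
     map fst (filter (\<lambda>(a, c). block_start \<tau> \<sigma> j \<le> c \<and> c < block_end \<tau> \<sigma> j)
                     (zip \<sigma> (align_cols \<tau> \<sigma>)))"

text \<open>The factor \<open>\<sigma>\<^sup>(\<^sup>k\<^sup>+\<^sup>1\<^sup>)\<close>.\<close>

definition bottom_tail :: "nat list \<Rightarrow> nat list \<Rightarrow> nat list" where
  "bottom_tail \<tau> \<sigma> =
     map fst (filter (\<lambda>(a, c). length \<tau> \<le> c) (zip \<sigma> (align_cols \<tau> \<sigma>)))"

text \<open>The number \<open>b\<^sub>j\<close>. If \<open>\<tau>\<^sup>(\<^sup>j\<^sup>)\<close> is empty, then so is \<open>\<sigma>\<^sup>(\<^sup>j\<^sup>)\<close>, and the value is
  taken to be 0.\<close>

definition shift_len :: "nat list \<Rightarrow> nat list \<Rightarrow> nat \<Rightarrow> nat" where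
  "shift_len \<tau> \<sigma> j =
     (let T = top_block \<tau> \<sigma> j; S = bottom_block \<tau> \<sigma> j in
      if T \<noteq> [] \<and> T ! 0 = gap_letter \<tau> \<sigma> j + 1
      then Max {b. b \<le> length T \<and> (\<forall>i\<in>{1..b}. T ! (i - 1) = S ! 0 + i)}
      else 0)"

definition hat_block :: "nat list \<Rightarrow> nat list \<Rightarrow> nat \<Rightarrow> nat list" where
  "hat_block \<tau> \<sigma> j =
     (let S = bottom_block \<tau> \<sigma> j; b = shift_len \<tau> \<sigma> j in
      map (\<lambda>i. if i < b then S ! i + 1 else S ! i) [0..<length S])"

text \<open>The pair (top row, bottom row).\<close>

definition drop_pair :: "nat list \<Rightarrow> nat list \<Rightarrow> nat list \<times> nat list" where
  "drop_pair \<tau> \<sigma> =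
     (let k = length (gaps \<tau> \<sigma>) in
      (concat (map (top_block \<tau> \<sigma>) [0..<k + 1]),
       bottom_block \<tau> \<sigma> 0
         @ concat (map (\<lambda>j. gap_letter \<tau> \<sigma> j # hat_block \<tau> \<sigma> j) [1..<k + 1])
         @ bottom_tail \<tau> \<sigma>))"

text \<open>A row sequence \<open>(\<rho>\<^sup>(\<^sup>m\<^sup>)|\<cdots>|\<rho>\<^sup>(\<^sup>1\<^sup>))\<close> is stored bottom row first, as the list
  \<open>[\<rho>\<^sup>(\<^sup>1\<^sup>), \<dots>, \<rho>\<^sup>(\<^sup>m\<^sup>)]\<close>: row \<open>i\<close> is \<open>\<rho> ! (i - 1)\<close>, and the concatenated word is
  \<open>concat (rev \<rho>)\<close>.\<close>

definition row_seqs :: "nat \<Rightarrow> nat list list set" where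
  "row_seqs m = {\<rho>. length \<rho> = m \<and> (\<forall>w\<in>set \<rho>. sorted_wrt (<) w) \<and> reduced_word (concat (rev \<rho>))}"

definition drop_row :: "nat \<Rightarrow> nat list list \<Rightarrow> nat list list" where
  "drop_row i \<rho> =
     (case drop_pair (\<rho> ! i) (\<rho> ! (i - 1)) of (top_row, bottom_row) \<Rightarrow>
       \<rho>[i := top_row, i - 1 := bottom_row])"

end

theory Submission
  imports Defs
begin

text \<open>The pair \<open>drop(\<tau>\<sigma>)\<close> is Edelman--Greene row insertion of the word \<open>\<sigma>\<close> into the row \<open>\<tau>\<close>: the bottom
  row is the resulting row, and the top row consists of the bumped letters. Its two rows form a
  tableau, into which insertion is trivial, so \<open>drop\<close> is idempotent. Applied to \<open>A|B|C\<close>,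
  the right-hand side of the braid relation computes the insertion tableau of the word \<open>ABC\<close>. On the
  left-hand side, the first step replaces \<open>B|C\<close> by \<open>b|c = drop(BC)\<close>. The words \<open>BC\<close> and \<open>bc\<close> are
  Coxeter--Knuth equivalent, so \<open>ABC\<close> and \<open>Abc\<close> have the same insertion tableau; and because \<open>b|c\<close> is
  itself a tableau, the two remaining steps already turn \<open>A|b|c\<close> into a tableau, so that a
  further drop of the upper two rows, which would complete the insertion, changes nothing.\<close>

section \<open>Inversions and factors of reduced words\<close>

lemma word_perm_simps:
  "word_perm [] = id"
  "word_perm (r # w) = transpose r (Suc r) \<circ> word_perm w"
  by (simp_all add: word_perm_def)

lemma word_perm_append: "word_perm (u @ v) = word_perm u \<circ> word_perm v"
  by (induction u) (simp_all add: word_perm_simps comp_assoc)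

lemma bij_word_perm: "bij (word_perm w)"
proof (induction w)
  case (Cons r w)
  have "bij (transpose r (Suc r))" by simp
  with Cons show ?case by (simp only: word_perm_simps bij_comp)
qed (simp only: word_perm_simps bij_id)

text \<open>Multiplying by \<open>transpose r (Suc r)\<close> on the left exchanges the values r and
  r+1, so only the two positions holding these values can change their relative order.\<close>

lemma inversions_transpose_comp:
  assumes "bij p"
  shows "inversions (transpose r (Suc r) \<circ> p) \<subseteq> insert (inv p r, inv p (Suc r)) (inversions p)"
proof
  fix ab assume "ab \<in> inversions (transpose r (Suc r) \<circ> p)"
  then obtain a b where ab: "ab = (a, b)" "1 \<le> a" "a < b"
    and less: "transpose r (Suc r) (p b) < transpose r (Suc r) (p a)"
    by (auto simp: inversions_def)
  have "p a \<noteq> p b"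
    using assms ab(3) by (metis bij_pointE less_irrefl)
  then have "p b < p a \<or> (p a = r \<and> p b = Suc r)"
    using less by (auto simp: transpose_def split: if_splits)
  then show "ab \<in> insert (inv p r, inv p (Suc r)) (inversions p)"
    using ab assms by (auto simp: inversions_def) (metis bij_is_inj inv_f_f)+
qed

text \<open>On the right the transposition exchanges positions: every other pair is merely
  relabelled. The bound on \<open>r\<close> keeps the relabelled positions among those that
  \<open>inversions\<close> counts.\<close>

lemma inversions_comp_transpose:
  assumes "1 \<le> r"
  shows "inversions (p \<circ> transpose r (Suc r)) \<subseteq>
    insert (r, Suc r) (map_prod (transpose r (Suc r)) (transpose r (Suc r)) ` inversions p)"
proof
  let ?s = "transpose r (Suc r)"
  fix ab assume "ab \<in> inversions (p \<circ> ?s)"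
  then obtain a b where ab: "ab = (a, b)" "1 \<le> a" "a < b" "p (?s b) < p (?s a)"
    by (auto simp: inversions_def)
  show "ab \<in> insert (r, Suc r) (map_prod ?s ?s ` inversions p)"
  proof (cases "a = r \<and> b = Suc r")
    case False
    then have "1 \<le> ?s a" "?s a < ?s b"
      using ab assms by (auto simp: transpose_def)
    then have "(?s a, ?s b) \<in> inversions p"
      using ab by (simp add: inversions_def)
    then have "map_prod ?s ?s (?s a, ?s b) \<in> map_prod ?s ?s ` inversions p"
      by (rule imageI)
    then show ?thesis using ab by simp
  qed (use ab in simp)
qed

lemma finite_inversions: "finite (inversions (word_perm w))"
proof (induction w)
  case Nil
  have "inversions id = {}" by (auto simp: inversions_def)
  then show ?case by (simp only: word_perm_simps) simp
next
  case (Cons r w)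
  then show ?case
    using finite_subset[OF inversions_transpose_comp[OF bij_word_perm]]
    by (simp only: word_perm_simps finite_insert)
qed

lemma card_inversions_append_le:
  "card (inversions (word_perm (u @ v))) \<le> length u + card (inversions (word_perm v))"
proof (induction u)
  case (Cons r u)
  have "card (inversions (word_perm ((r # u) @ v))) \<le> Suc (card (inversions (word_perm (u @ v))))"
    using card_mono[OF _ inversions_transpose_comp[OF bij_word_perm, of r "u @ v"]]
    unfolding append_Cons word_perm_simps
    by (auto simp: finite_inversions card_insert_if split: if_splits)
  then show ?case using Cons by simp
qed simp

lemma card_inversions_append_le':
  assumes "\<forall>r\<in>set v. 1 \<le> r"
  shows "card (inversions (word_perm (u @ v))) \<le> card (inversions (word_perm u)) + length v"
  using assms
proof (induction v rule: rev_induct)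
  case (snoc r v)
  let ?s = "transpose r (Suc r)" and ?I = "inversions (word_perm (u @ v))"
  have "word_perm (u @ v @ [r]) = word_perm (u @ v) \<circ> ?s"
    unfolding word_perm_append word_perm_simps by (simp only: comp_assoc comp_id)
  then have "inversions (word_perm (u @ v @ [r])) \<subseteq> insert (r, Suc r) (map_prod ?s ?s ` ?I)"
    using inversions_comp_transpose[of r "word_perm (u @ v)"] snoc.prems by simp
  then have "card (inversions (word_perm (u @ v @ [r]))) \<le> card (insert (r, Suc r) (map_prod ?s ?s ` ?I))"
    by (intro card_mono) (auto simp: finite_inversions)
  also have "\<dots> \<le> Suc (card (map_prod ?s ?s ` ?I))"
    by (simp add: card_insert_le_m1 card_insert_if finite_inversions)
  also have "\<dots> \<le> Suc (card ?I)"
    by (simp add: card_image_le finite_inversions)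
  finally show ?case using snoc by simp
qed simp

text \<open>A letter on either side adds at most one inversion, so a deficit in the factor could not
  be made up by \<open>p\<close> and \<open>q\<close>. The third bound below, with an empty right
  part, excludes a surplus.\<close>

lemma reduced_word_factor:
  assumes "reduced_word (p @ u @ q)"
  shows "reduced_word u"
proof -
  let ?l = "\<lambda>w. card (inversions (word_perm w))"
  have "?l (p @ u @ q) \<le> length p + ?l (u @ q)" "?l (u @ q) \<le> ?l u + length q"
    and "?l (u @ []) \<le> length u + ?l []"
    using assms by (intro card_inversions_append_le card_inversions_append_le'; auto simp: reduced_word_def)+
  moreover have "inversions (word_perm []) = {}"
    by (auto simp: inversions_def word_perm_simps)
  ultimately show ?thesis
    using assms by (auto simp: reduced_word_def)
qed

lemma not_reduced_word_square: "\<not> reduced_word [x, x]"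
proof -
  have "inversions (word_perm [x, x]) = {}"
    by (auto simp: inversions_def word_perm_simps)
  then show ?thesis by (simp add: reduced_word_def)
qed

section \<open>Coxeter--Knuth equivalence of words\<close>

lemma word_perm_commute:
  assumes "Suc a < b"
  shows "word_perm [a, b] = word_perm [b, a]"
  using assms by (auto simp: fun_eq_iff transpose_def word_perm_simps)

lemma word_perm_braid: "word_perm [x, Suc x, x] = word_perm [Suc x, x, Suc x]"
  by (auto simp: fun_eq_iff transpose_def word_perm_simps)

lemma reduced_word_same_perm:
  assumes "reduced_word (p @ u @ q)" "word_perm u = word_perm v" "length u = length v"
    "set u = set v"
  shows "reduced_word (p @ v @ q)"
  using assms by (auto simp: reduced_word_def word_perm_append)

text \<open>These are the elementary Coxeter--Knuth relations. In the first two, the neighbour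
  \<open>b\<close> witnesses that \<open>a\<close> and \<open>c\<close> differ by at least 2, so
  exchanging them does not change the permutation.\<close>

inductive ck_move :: "nat list \<Rightarrow> nat list \<Rightarrow> bool" where
  "a < b \<Longrightarrow> b < c \<Longrightarrow> ck_move [a, c, b] [c, a, b]"
| "a < b \<Longrightarrow> b < c \<Longrightarrow> ck_move [b, a, c] [b, c, a]"
| "ck_move [x, Suc x, x] [Suc x, x, Suc x]"

inductive coxeter_knuth :: "nat list \<Rightarrow> nat list \<Rightarrow> bool" where
  ck_step: "ck_move u v \<Longrightarrow> coxeter_knuth (p @ u @ q) (p @ v @ q)"
| ck_refl: "coxeter_knuth u u"
| ck_sym: "coxeter_knuth u v \<Longrightarrow> coxeter_knuth v u"
| ck_trans [trans]: "coxeter_knuth u v \<Longrightarrow> coxeter_knuth v w \<Longrightarrow> coxeter_knuth u w"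

lemma ck_context: "coxeter_knuth u v \<Longrightarrow> coxeter_knuth (p @ u @ q) (p @ v @ q)"
proof (induction rule: coxeter_knuth.induct)
  case (ck_step u v p' q')
  then show ?case
    using coxeter_knuth.ck_step[of u v "p @ p'" "q' @ q"] by simp
qed (auto intro: coxeter_knuth.intros)

lemma ck_move_word:
  assumes "ck_move u v"
  shows "word_perm u = word_perm v" "length u = length v" "set u = set v"
proof -
  show "word_perm u = word_perm v"
    using assms
  proof cases
    case (1 a b c)
    then have "word_perm [a, c] = word_perm [c, a]"
      by (intro word_perm_commute) simp
    then show ?thesis
      unfolding 1 using word_perm_append[of "[a, c]" "[b]"] word_perm_append[of "[c, a]" "[b]"] by simp
  next
    case (2 a b c)
    then have "word_perm [a, c] = word_perm [c, a]"
      by (intro word_perm_commute) simp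
    then show ?thesis
      unfolding 2 using word_perm_append[of "[b]" "[a, c]"] word_perm_append[of "[b]" "[c, a]"] by simp
  next
    case 3
    then show ?thesis using word_perm_braid by simp
  qed
qed (use assms in \<open>cases; auto\<close>)+

lemma ck_word:
  assumes "coxeter_knuth u v"
  shows "word_perm u = word_perm v" "length u = length v" "set u = set v"
  using assms
  by (induction rule: coxeter_knuth.induct) (auto simp: word_perm_append dest: ck_move_word)

lemma ck_reduced_word:
  "coxeter_knuth u v \<Longrightarrow> reduced_word (p @ u @ q) \<Longrightarrow> reduced_word (p @ v @ q)"
  using reduced_word_same_perm ck_word by metis

section \<open>Edelman--Greene insertion into a row\<close>

text \<open>The letter \<open>x\<close> passes the letters of \<open>R\<close> from right to left.
  The left neighbour of the letter being passed lies strictly between \<open>x\<close> and that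
  letter, so it is the witness for a move of the second kind.\<close>

lemma ck_move_left:
  assumes "sorted_wrt (<) (a # R)" "x < a"
  shows "coxeter_knuth (a # R @ [x]) (a # x # R)"
  using assms
proof (induction R arbitrary: a)
  case (Cons r R)
  have "coxeter_knuth (a # r # R @ [x]) (a # r # x # R)"
    using Cons ck_context[of "r # R @ [x]" "r # x # R" "[a]" "[]"] by simp
  also have "coxeter_knuth (a # r # x # R) (a # x # r # R)"
    using Cons.prems coxeter_knuth.ck_sym[OF coxeter_knuth.ck_step[OF ck_move.intros(2)[of x a r], of "[]" R]] by simp
  finally show ?case by simp
qed (simp add: coxeter_knuth.ck_refl)

lemma word_perm_move_left:
  "\<forall>r\<in>set R. Suc x < r \<Longrightarrow> word_perm (R @ [x]) = word_perm (x # R)"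
proof (induction R)
  case (Cons r R)
  have "word_perm (R @ [x]) = word_perm (x # R)"
    using Cons by simp
  then have "word_perm ((r # R) @ [x]) = word_perm [r, x] \<circ> word_perm R"
    unfolding append_Cons word_perm_simps by (simp only: comp_assoc id_comp)
  also have "\<dots> = word_perm [x, r] \<circ> word_perm R"
    using Cons.prems word_perm_commute[of x r] by simp
  finally show ?case
    unfolding word_perm_simps by (simp only: comp_assoc id_comp)
qed simp

text \<open>Without \<open>Suc x\<close>, all letters to the right of \<open>x\<close> in
  \<open>R\<close> exceed \<open>Suc x\<close>; the appended \<open>x\<close> commutes past them and
  meets the first one, which leaves a square in a reduced word.\<close>

lemma reduced_word_row_repeated:
  assumes "sorted_wrt (<) R" "x \<in> set R" "reduced_word (R @ [x])"
  shows "Suc x \<in> set R"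
proof (rule ccontr)
  assume x: "Suc x \<notin> set R"
  obtain R1 R2 where R: "R = R1 @ x # R2"
    using assms(2) by (metis split_list)
  have "\<forall>r\<in>set R2. Suc x < r"
    using assms(1) x by (auto simp: R sorted_wrt_append) (metis Suc_lessI)
  then have "word_perm (R2 @ [x]) = word_perm (x # R2)"
    by (rule word_perm_move_left)
  then have "reduced_word ((R1 @ [x]) @ (x # R2) @ [])"
    using assms(3) reduced_word_same_perm[of "R1 @ [x]" "R2 @ [x]" "[]" "x # R2"] by (simp add: R)
  then have "reduced_word (R1 @ [x, x] @ R2)"
    by simp
  then show False
    using reduced_word_factor not_reduced_word_square by blast
qed

text \<open>The middle case of Edelman--Greene insertion presupposes \<open>Suc x\<close> in the row, which
  \<open>reduced_word_row_repeated\<close> guarantees.\<close>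

fun ins_row :: "nat list \<Rightarrow> nat \<Rightarrow> nat list" where
  "ins_row [] x = [x]"
| "ins_row (a # R) x = (if x < a then x # R else if x = a then a # R else a # ins_row R x)"

fun ins_out :: "nat list \<Rightarrow> nat \<Rightarrow> nat list" where
  "ins_out [] x = []"
| "ins_out (a # R) x = (if x < a then [a] else if x = a then [Suc a] else ins_out R x)"

fun word_row :: "nat list \<Rightarrow> nat list \<Rightarrow> nat list" where
  "word_row R [] = R"
| "word_row R (x # u) = word_row (ins_row R x) u"

fun word_out :: "nat list \<Rightarrow> nat list \<Rightarrow> nat list" where
  "word_out R [] = []"
| "word_out R (x # u) = ins_out R x @ word_out (ins_row R x) u"

lemma word_row_append: "word_row R (u @ v) = word_row (word_row R u) v"
  by (induction u arbitrary: R) simp_all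

lemma word_out_append: "word_out R (u @ v) = word_out R u @ word_out (word_row R u) v"
  by (induction u arbitrary: R) simp_all

lemma set_ins_row_subset: "set (ins_row R x) \<subseteq> insert x (set R)"
  by (induction R) auto

lemma sorted_ins_row: "sorted_wrt (<) R \<Longrightarrow> sorted_wrt (<) (ins_row R x)"
proof (induction R)
  case (Cons a R)
  then show ?case using set_ins_row_subset[of R x] by fastforce
qed simp

lemma sorted_word_row: "sorted_wrt (<) R \<Longrightarrow> sorted_wrt (<) (word_row R u)"
  by (induction u arbitrary: R) (simp_all add: sorted_ins_row)

lemma ins_out_singleton:
  assumes "ins_out R x \<noteq> []"
  shows "\<exists>y r R'. ins_out R x = [y] \<and> ins_row R x = r # R' \<and> r \<le> x \<and> x < y"
  using assms by (induction R x rule: ins_out.induct) auto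

text \<open>Induction along the row: the letter bumped from the tail must be carried to the left of
  each head that the inserted letter has passed.\<close>

lemma ck_ins:
  assumes "sorted_wrt (<) R" "reduced_word (R @ [x])"
  shows "coxeter_knuth (R @ [x]) (ins_out R x @ ins_row R x)"
  using assms
proof (induction R)
  case (Cons a R)
  consider "x < a" | "x = a" | "a < x" by linarith
  then show ?case
  proof cases
    case 1
    then show ?thesis
      using Cons.prems ck_move_left[of a R x] by simp
  next
    case 2
    \<comment> \<open>Reducedness puts \<open>Suc a\<close> directly after \<open>a\<close>. The
      appended \<open>a\<close> travels left up to \<open>Suc a\<close>, and the braid relation then
      turns the leading a, a+1, a into a+1, a, a+1, which brings the bumped letter to the
      front.\<close>
    then have "Suc a \<in> set R"
      using reduced_word_row_repeated[OF Cons.prems(1), of a] Cons.prems(2) by auto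
    then obtain R2 where R: "R = Suc a # R2"
      using Cons.prems(1) by (cases R) (auto dest: Suc_leI leD)
    have "coxeter_knuth (a # Suc a # R2 @ [a]) (a # Suc a # a # R2)"
      using Cons.prems(1) ck_context[OF ck_move_left[of "Suc a" R2 a], of "[a]" "[]"] by (simp add: R)
    also have "coxeter_knuth (a # Suc a # a # R2) (Suc a # a # Suc a # R2)"
      using coxeter_knuth.ck_step[OF ck_move.intros(3)[of a], of "[]" R2] by simp
    finally show ?thesis using 2 by (simp add: R)
  next
    case 3
    have "reduced_word (R @ [x])"
      using Cons.prems(2) reduced_word_factor[of "[a]" "R @ [x]" "[]"] by simp
    then have IH: "coxeter_knuth (R @ [x]) (ins_out R x @ ins_row R x)"
      using Cons by simp
    then have *: "coxeter_knuth (a # R @ [x]) (a # ins_out R x @ ins_row R x)"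
      using ck_context[OF IH, of "[a]" "[]"] by simp
    show ?thesis
    proof (cases "ins_out R x = []")
      case True
      then show ?thesis using * 3 by simp
    next
      case False
      then obtain y r R' where r: "ins_out R x = [y]" "ins_row R x = r # R'" "r \<le> x" "x < y"
        using ins_out_singleton by blast
      have "a < r"
        using Cons.prems(1) 3 set_ins_row_subset[of R x] r(2) by auto
      \<comment> \<open>Here a < r \<le> x < y: the new head \<open>r\<close> of the tail is the
        witness for exchanging \<open>a\<close> and the bumped letter \<open>y\<close>.\<close>
      then have "coxeter_knuth ([] @ [a, y, r] @ R') ([] @ [y, a, r] @ R')"
        using r by (intro coxeter_knuth.ck_step ck_move.intros) auto
      then show ?thesis
        using * 3 r by (auto intro: coxeter_knuth.ck_trans)
    qed
  qed
qed (simp add: coxeter_knuth.ck_refl)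

lemma ck_word_ins:
  assumes "sorted_wrt (<) R" "reduced_word (R @ u)"
  shows "coxeter_knuth (R @ u) (word_out R u @ word_row R u)"
  using assms
proof (induction u arbitrary: R)
  case (Cons x u)
  have "reduced_word (R @ [x])"
    using Cons.prems(2) reduced_word_factor[of "[]" "R @ [x]" u] by simp
  then have ck_move: "coxeter_knuth (R @ [x]) (ins_out R x @ ins_row R x)"
    using Cons.prems(1) ck_ins by blast
  then have "reduced_word (ins_out R x @ ins_row R x @ u)"
    using ck_reduced_word[OF ck_move, of "[]" u] Cons.prems(2) by simp
  then have "reduced_word (ins_row R x @ u)"
    using reduced_word_factor[of "ins_out R x" "ins_row R x @ u" "[]"] by simp
  then have ck2: "coxeter_knuth (ins_row R x @ u) (word_out (ins_row R x) u @ word_row (ins_row R x) u)"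
    using Cons sorted_ins_row by blast
  have "coxeter_knuth ((R @ [x]) @ u) ((ins_out R x @ ins_row R x) @ u)"
    using ck_context[OF ck_move, of "[]" u] by simp
  also have "coxeter_knuth ((ins_out R x @ ins_row R x) @ u)
      (ins_out R x @ word_out (ins_row R x) u @ word_row (ins_row R x) u)"
    using ck_context[OF ck2, of "ins_out R x" "[]"] by simp
  finally show ?case by simp
qed (simp add: coxeter_knuth.ck_refl)

section \<open>Insertion respects Coxeter--Knuth equivalence\<close>

text \<open>The letter \<open>y\<close> is the one that \<open>x\<close> bumps from the row \<open>R\<close>; the bound \<open>N\<close> stands for it
  when \<open>x\<close> is appended and bumps nothing.\<close>

definition bump :: "nat \<Rightarrow> nat set \<Rightarrow> nat \<Rightarrow> nat \<Rightarrow> nat set \<Rightarrow> bool" where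
  "bump N R x y R' \<longleftrightarrow> x < y \<and> (y \<in> R \<or> y = N) \<and> (\<forall>z\<in>R. x < z \<longrightarrow> y \<le> z) \<and> (\<forall>z\<in>R. z < N) \<and>
    (x \<in> R \<longrightarrow> Suc x \<in> R) \<and> R' = (if x \<in> R then R else insert x (R - {y}))"

text \<open>A strictly increasing row is determined by its set of letters, so the comparison of
  insertion orders can be carried out on sets. The filter erases the formal letter
  \<open>N\<close>.\<close>

lemma bump_ins:
  assumes "sorted_wrt (<) R" "x \<in> set R \<Longrightarrow> Suc x \<in> set R" "\<forall>z\<in>set R. z < N" "x < N"
  shows "\<exists>y. bump N (set R) x y (set (ins_row R x)) \<and> ins_out R x = filter (\<lambda>z. z < N) [y]"
  using assms
proof (induction R)
  case Nil
  then show ?case by (auto simp: bump_def)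
next
  case (Cons a R)
  consider "x < a" | "x = a" | "a < x" by linarith
  then show ?case
  proof cases
    case 1
    then show ?thesis
      using Cons.prems by (intro exI[of _ a]) (auto simp: bump_def)
  next
    case 2
    then show ?thesis
      using Cons.prems by (intro exI[of _ "Suc a"]) (auto simp: bump_def)
  next
    case 3
    then have "x \<in> set R \<Longrightarrow> Suc x \<in> set R"
      using Cons.prems(2) by auto
    then obtain y where "bump N (set R) x y (set (ins_row R x))" "ins_out R x = filter (\<lambda>z. z < N) [y]"
      using Cons by auto
    then show ?thesis
      using Cons.prems 3 by (intro exI[of _ y]) (auto simp: bump_def)
  qed
qed

lemma bumpD:
  assumes "bump N R x y R'"
  shows "x < y" "y \<le> N" "x \<in> R'" "y \<in> R \<or> y = N" "\<And>z. z \<in> R \<Longrightarrow> x < z \<Longrightarrow> y \<le> z" "R' \<subseteq> insert x R"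
    "x \<notin> R \<Longrightarrow> R' = insert x (R - {y})"
  using assms by (auto simp: bump_def split: if_splits)

lemma bump_unique: "bump N R x y R1 \<Longrightarrow> bump N R x z R2 \<Longrightarrow> y = z \<and> R1 = R2"
  unfolding bump_def by (metis leD linorder_neqE_nat)

text \<open>Bumped triples may contain the formal letter \<open>N\<close>; the actual words of
  bumped letters arise by erasing it.\<close>

definition coxeter_knuth_below :: "nat \<Rightarrow> nat list \<Rightarrow> nat list \<Rightarrow> bool" where
  "coxeter_knuth_below N u v \<longleftrightarrow> coxeter_knuth (filter (\<lambda>z. z < N) u) (filter (\<lambda>z. z < N) v)"

lemma ck_move_imp_ck: "ck_move u v \<Longrightarrow> coxeter_knuth u v"
  using coxeter_knuth.ck_step[of u v "[]" "[]"] by simp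

lemma ck_below_sym: "coxeter_knuth_below N u v \<Longrightarrow> coxeter_knuth_below N v u"
  by (simp add: coxeter_knuth_below_def coxeter_knuth.ck_sym)

text \<open>If the largest letter is \<open>N\<close>, erasing it makes both sides of a commutation
  move equal. In the second move two letters may be \<open>N\<close> at once, when two insertions
  bump nothing.\<close>

lemma ck_below_cases:
  "a < b \<Longrightarrow> b < c \<Longrightarrow> c \<le> N \<Longrightarrow> coxeter_knuth_below N [a, c, b] [c, a, b]"
  "a < b \<Longrightarrow> b < c \<or> (b = c \<and> c = N) \<Longrightarrow> c \<le> N \<Longrightarrow> coxeter_knuth_below N [b, a, c] [b, c, a]"
  "Suc x < N \<Longrightarrow> coxeter_knuth_below N [x, Suc x, x] [Suc x, x, Suc x]"
  by (auto simp: coxeter_knuth_below_def coxeter_knuth.ck_refl intro: ck_move_imp_ck ck_move.intros)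

text \<open>Inserting \<open>a\<close> concerns only the part of the row from \<open>a\<close> to
  \<open>y1\<close>, inserting \<open>c\<close> only the part from \<open>c\<close> to
  \<open>y3\<close>. As a < y1 < c < y3, the two do not interfere.\<close>

lemma bump_commute:
  assumes "bump N R a y1 R1" "y1 < c" "bump N R1 c y3 R2"
  obtains S where "bump N R c y3 S" "bump N S a y1 R2"
proof
  let ?S = "if c \<in> R then R else insert c (R - {y3})"
  have "a < y1" "c < y3" "y3 \<le> N"
    using assms(1,3) by (auto simp: bump_def split: if_splits)
  moreover from this assms(2) have "y1 < N"
    by simp
  ultimately show "bump N R c y3 ?S" "bump N ?S a y1 R2"
    using assms by (auto simp: bump_def split: if_splits)
qed

text \<open>The cases compare \<open>c\<close> with the letter \<open>y1\<close> that
  \<open>a\<close> bumps from the original row. The type of move relating the bumped triples depends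
  on the case and need not be that of the inserted triples.\<close>

lemma bump_knuth1:
  assumes "a < b" "b < c"
    and R: "bump N R a y1 R1" "bump N R1 c y3 R2" "bump N R2 b y2 R3"
    and S: "bump N R c z3 S1" "bump N S1 a z1 S2" "bump N S2 b z2 S3"
  shows "R3 = S3 \<and> coxeter_knuth_below N [y1, y3, y2] [z3, z1, z2]"
proof -
  consider "c < y1" | "y1 = c" | "y1 < c" by linarith
  then show ?thesis
  proof cases
    \<comment> \<open>Both \<open>a\<close> and \<open>c\<close> aim at the same letter
      \<open>y1\<close>. The bumped triples are y1, y3, c and y1, c, y3, related by a move of the
      second kind.\<close>
    case 1
    have "a < c" using assms(1,2) by simp
    then have notin: "a \<notin> R" "c \<notin> R"
      using 1 R(1) unfolding bump_def by (metis Suc_leI assms(1,2) leD le_less_trans lessI less_trans, metis leD)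
    have R1: "R1 = insert a (R - {y1})"
      using R(1) notin by (simp add: bump_def)
    have "bump N R c y1 (insert c (R - {y1}))"
      using 1 R(1) notin assms(1,2) by (auto simp: bump_def)
    then have z3: "z3 = y1" "S1 = insert c (R - {y1})"
      using S(1) bump_unique by blast+
    have "bump N S1 a c R1"
      using 1 R(1,2) notin assms(1,2) unfolding z3 R1 by (auto simp: bump_def split: if_splits)
    then have z1: "z1 = c" "S2 = R1"
      using S(2) bump_unique by blast+
    have R2: "R2 = insert c (R1 - {y3})"
      using R(2) notin assms(1,2) R1 by (simp add: bump_def)
    have b: "\<forall>z\<in>R1. z \<le> a \<or> y1 < z"
      using R(1) R1 by (auto simp: bump_def)
    have "bump N R2 b c (insert b (R1 - {y3}))"
      using b 1 R(2) notin assms(1,2) unfolding R2 by (auto simp: bump_def split: if_splits)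
    then have y2: "y2 = c" "R3 = insert b (R1 - {y3})"
      using R(3) bump_unique by blast+
    have "bump N S2 b y3 (insert b (R1 - {y3}))"
      using b 1 R(2) notin assms(1,2) unfolding z1 by (auto simp: bump_def split: if_splits)
    then have z2: "z2 = y3" "S3 = insert b (R1 - {y3})"
      using S(3) bump_unique by blast+
    have "y3 \<in> R1 \<or> y3 = N" "c < y3" "\<forall>z\<in>R1. z < N"
      using R(2) by (auto simp: bump_def)
    moreover have "y1 \<le> N"
      using R(1) by (auto simp: bump_def)
    moreover have "y3 \<le> a \<or> y1 < y3" if "y3 \<in> R1"
      using b that by blast
    ultimately have "y1 < y3 \<or> (y1 = y3 \<and> y3 = N)" "y3 \<le> N"
      using \<open>a < c\<close> by (auto simp: less_le)
    then show ?thesis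
      using ck_below_cases(2)[of c y1 y3 N] 1 by (auto simp: y2 z1 z2 z3 intro: ck_below_sym)
  next
    \<comment> \<open>Now \<open>c\<close> is in the row, hence so is \<open>Suc c\<close>. The
      bumped triples are c, c+1, c and c+1, c, c+1: a commutation among the inserted letters
      produces a braid among the bumped ones.\<close>
    case 2
    have in_R: "c \<in> R" "Suc c \<in> R" "a \<notin> R" "c < N" "Suc c < N"
      using 2 assms(1,2) R(1) S(1) by (auto simp: bump_def)
    have R1: "R1 = insert a (R - {c})"
      using R(1) 2 in_R by (simp add: bump_def)
    have b: "\<forall>z\<in>R1. z \<le> a \<or> c < z"
      using R(1) R1 2 by (auto simp: bump_def)
    have "a < c" using assms(1,2) by simp
    then have "c \<notin> R1" "Suc c \<in> R1"
      using in_R by (simp_all add: R1)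
    moreover have "b \<notin> R1"
      using bspec[OF b, of b] assms(1,2) by linarith
    moreover have "\<forall>z\<in>R1. z < N"
      using R(2) by (simp add: bump_def)
    ultimately have R1_facts: "c \<notin> R1" "Suc c \<in> R1" "b \<notin> R1" "\<forall>z\<in>R1. z < N"
      by blast+
    then have "bump N R1 c (Suc c) (insert c (R1 - {Suc c}))"
      by (auto simp: bump_def)
    then have y3: "y3 = Suc c" "R2 = insert c (R1 - {Suc c})"
      using R(2) bump_unique by blast+
    have "bump N R2 b c (insert b (R1 - {Suc c}))"
      using R1_facts b \<open>c < N\<close> assms(1,2) by (auto simp: bump_def y3)
    then have y2: "y2 = c" "R3 = insert b (R1 - {Suc c})"
      using R(3) bump_unique by blast+
    have "bump N R c (Suc c) R"
      using in_R R(1) by (auto simp: bump_def)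
    then have z3: "z3 = Suc c" "S1 = R"
      using S(1) bump_unique by blast+
    then have z1: "z1 = c" "S2 = R1"
      using S(2) R(1) bump_unique 2 by blast+
    have "bump N R1 b (Suc c) (insert b (R1 - {Suc c}))"
      using R1_facts b assms(1,2) by (auto simp: bump_def)
    then have z2: "z2 = Suc c" "S3 = insert b (R1 - {Suc c})"
      using S(3) bump_unique z1 by blast+
    show ?thesis
      using ck_below_cases(3)[of c N] in_R by (simp add: 2 y2 y3 z1 z2 z3)
  next
    \<comment> \<open>The insertions of \<open>a\<close> and \<open>c\<close> commute, and y1 < y2 <
      y3 makes the bumped triples a move of the first kind.\<close>
    case 3
    then obtain S where "bump N R c y3 S" "bump N S a y1 R2"
      using bump_commute[OF R(1) _ R(2)] by blast
    then have z: "z3 = y3" "z1 = y1" "S2 = R2"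
      using S(1,2) bump_unique by blast+
    then have z2: "z2 = y2" "S3 = R3"
      using R(3) S(3) bump_unique by blast+
    have "y2 \<le> c" "c < y3" "y3 \<le> N"
      using bumpD[OF R(2)] bumpD(5)[OF R(3)] assms(2) by auto
    moreover have "y1 < y2"
    proof (cases "y1 \<le> b")
      case True
      then show ?thesis using bumpD(1)[OF R(3)] by simp
    next
      case False
      then have "a \<notin> R"
        using R(1) assms(1) by (auto simp: bump_def)
      then have "y2 \<in> R - {y1} \<or> y2 = a \<or> y2 = c \<or> y2 = N"
        using bumpD(4)[OF R(3)] bumpD(6)[OF R(2)] bumpD(7)[OF R(1)] by blast
      then show ?thesis
        using bumpD(1)[OF R(3)] bumpD(5)[OF R(1), of y2] \<open>y2 \<le> c\<close> \<open>c < y3\<close> \<open>y3 \<le> N\<close> assms(1) 3 by auto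
    qed
    ultimately show ?thesis
      using ck_below_cases(1)[of y1 y2 y3 N] by (simp add: z z2)
  qed
qed

text \<open>Once \<open>b\<close> is in the row, \<open>a\<close> bumps some y1 \<le> b < c, so the
  later insertions of \<open>a\<close> and \<open>c\<close> commute. As y1 \<le> b < y2, the bumped
  triples form a move of the second kind.\<close>

lemma bump_knuth2:
  assumes "a < b" "b < c"
    and R: "bump N R b y2 R1" "bump N R1 a y1 R2" "bump N R2 c y3 R3"
    and S: "bump N R b z2 S1" "bump N S1 c z3 S2" "bump N S2 a z1 S3"
  shows "R3 = S3 \<and> coxeter_knuth_below N [y2, y1, y3] [z2, z3, z1]"
proof -
  have S1: "z2 = y2" "S1 = R1"
    using R(1) S(1) bump_unique by blast+
  have y1: "y1 \<le> b" "b < y2"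
    using R(1,2) assms(1) by (auto simp: bump_def split: if_splits)
  then obtain T where T: "bump N R1 c y3 T" "bump N T a y1 R3"
    using bump_commute[OF R(2) _ R(3)] assms(2) by (metis le_less_trans)
  then have z: "z3 = y3" "z1 = y1" "S3 = R3"
    using S(2,3) S1 bump_unique by blast+
  have "y2 < y3 \<or> (y2 = y3 \<and> y3 = N)" "y3 \<le> N"
    using R(1) T(1) assms(2) by (auto simp: bump_def split: if_splits)
  then show ?thesis
    using ck_below_cases(2)[of y1 y2 y3 N] y1 by (auto simp: S1 z)
qed

text \<open>The middle case of insertion leaves three possibilities. If \<open>Suc x\<close> is in
  the row, so is its successor, and the two orders bump the two sides of the braid on x+1 and x+2.
  Otherwise both orders first bump the same \<open>y1\<close>, and the other two letters,
  \<open>Suc x\<close> and \<open>y2\<close>, come out in opposite orders.\<close>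

lemma bump_braid:
  assumes R: "bump N R x y1 R1" "bump N R1 (Suc x) y2 R2" "bump N R2 x y3 R3"
    and S: "bump N R (Suc x) z1 S1" "bump N S1 x z2 S2" "bump N S2 (Suc x) z3 S3"
  shows "R3 = S3 \<and> coxeter_knuth_below N [y1, y2, y3] [z1, z2, z3]"
proof -
  consider "x \<in> R" "Suc x \<in> R" "Suc (Suc x) \<in> R" | "x \<notin> R" "Suc x \<in> R" "Suc (Suc x) \<in> R"
    | "x \<notin> R" "Suc x \<notin> R"
    using R(1) S(1) by (auto simp: bump_def)
  then show ?thesis
  proof cases
    case 1
    then have "bump N R x (Suc x) R" "bump N R (Suc x) (Suc (Suc x)) R"
      using R(1) by (auto simp: bump_def)
    then have "y1 = Suc x" "y2 = Suc (Suc x)" "y3 = Suc x" "R3 = R"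
      "z1 = Suc (Suc x)" "z2 = Suc x" "z3 = Suc (Suc x)" "S3 = R"
      using R S bump_unique by blast+
    moreover have "Suc (Suc x) < N"
      using 1 R(1) by (simp add: bump_def)
    ultimately show ?thesis
      using ck_below_cases(3)[of "Suc x" N] by simp
  next
    case 2
    let ?T = "insert x (R - {Suc x})" and ?U = "insert x (R - {Suc (Suc x)})"
    have N: "x < N" "Suc x < N" "Suc (Suc x) < N" "\<forall>z\<in>R. z < N"
      using 2 R(1) by (auto simp: bump_def)
    have b: "bump N R x (Suc x) ?T" "bump N ?T (Suc x) (Suc (Suc x)) ?U" "bump N ?U x (Suc x) ?U"
      "bump N R (Suc x) (Suc (Suc x)) R"
      using 2 N by (auto simp: bump_def)
    then have "y1 = Suc x" "y2 = Suc (Suc x)" "y3 = Suc x" "R3 = ?U"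
      "z1 = Suc (Suc x)" "z2 = Suc x" "z3 = Suc (Suc x)" "S3 = ?U"
      using R S bump_unique by blast+
    then show ?thesis
      using ck_below_cases(3)[of "Suc x" N] N by simp
  next
    case 3
    let ?T = "insert x (R - {y1})" and ?S = "insert (Suc x) (R - {y1})"
    let ?U = "insert (Suc x) (?T - {y2})"
    have N: "\<forall>z\<in>R. z < N" "Suc x < N"
      using R(1) bumpD(1,2)[OF R(2)] by (auto simp: bump_def)
    have R1: "R1 = ?T"
      using bumpD(7)[OF R(1)] 3 by simp
    have y1: "Suc x < y1" "y1 \<le> N"
      using bumpD[OF R(1)] 3 N(2) by (metis Suc_lessI, blast)
    have R2: "R2 = ?U"
      using bumpD(7)[OF R(2)] 3 unfolding R1 by simp
    have "y2 \<in> R - {y1} \<or> y2 = N"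
      using bumpD(1,4)[OF R(2)] unfolding R1 by auto
    then have y2: "y1 < y2 \<or> (y1 = y2 \<and> y2 = N)" "y2 \<le> N"
      using bumpD(5)[OF R(1), of y2] bumpD(1,2)[OF R(2)] y1(2) by (auto simp: less_le)
    have z1: "bump N R (Suc x) y1 ?S"
      using 3 y1 bumpD(4,5)[OF R(1)] N by (auto simp: bump_def)
    have z2: "bump N ?S x (Suc x) ?T"
      using 3 y1 N by (auto simp: bump_def)
    have "bump N ?U x (Suc x) ?U"
      using y1 y2 N by (auto simp: bump_def)
    then have "y3 = Suc x" "R3 = ?U" "z1 = y1" "z2 = Suc x" "z3 = y2" "S3 = ?U"
      using R S z1 z2 bump_unique unfolding R1 R2 by blast+
    then show ?thesis
      using ck_below_cases(2)[of "Suc x" y1 y2 N] y1 y2 by (auto intro: ck_below_sym)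
  qed
qed

text \<open>Reducedness supplies \<open>Suc x\<close> whenever the inserted \<open>x\<close> is
  already present, as \<open>bump\<close> demands. It survives each insertion, because the new row
  followed by the remaining letters is a factor of an equivalent word.\<close>

lemma word_ins_three_bumps:
  assumes "sorted_wrt (<) R" "reduced_word (R @ [x1, x2, x3])" "\<forall>z\<in>set (R @ [x1, x2, x3]). z < N"
  shows "\<exists>y1 y2 y3 R1 R2. bump N (set R) x1 y1 R1 \<and> bump N R1 x2 y2 R2 \<and>
    bump N R2 x3 y3 (set (word_row R [x1, x2, x3])) \<and>
    word_out R [x1, x2, x3] = filter (\<lambda>z. z < N) [y1, y2, y3]"
proof -
  have *: "\<exists>y. bump N (set Q) x y (set (ins_row Q x)) \<and> ins_out Q x = filter (\<lambda>z. z < N) [y] \<and>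
      sorted_wrt (<) (ins_row Q x) \<and> reduced_word (ins_row Q x @ u) \<and>
      (\<forall>z\<in>set (ins_row Q x @ u). z < N)"
    if Q: "sorted_wrt (<) Q" "reduced_word (Q @ x # u)" "\<forall>z\<in>set (Q @ x # u). z < N" for Q x u
  proof -
    have red: "reduced_word (Q @ [x])"
      using Q(2) reduced_word_factor[of "[]" "Q @ [x]" u] by simp
    then have "reduced_word ([] @ (ins_out Q x @ ins_row Q x) @ u)"
      using ck_reduced_word[OF ck_ins, OF Q(1) red, of "[]" u] Q(2) by simp
    then have "reduced_word (ins_row Q x @ u)"
      using reduced_word_factor[of "ins_out Q x" "ins_row Q x @ u" "[]"] by simp
    moreover obtain y where "bump N (set Q) x y (set (ins_row Q x))" "ins_out Q x = filter (\<lambda>z. z < N) [y]"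
      using bump_ins[of Q x N] reduced_word_row_repeated[OF Q(1) _ red] Q by auto
    moreover have "\<forall>z\<in>set (ins_row Q x @ u). z < N"
      using Q(3) set_ins_row_subset[of Q x] by auto
    ultimately show ?thesis
      using sorted_ins_row[OF Q(1)] by blast
  qed
  show ?thesis
  proof -
    let ?R1 = "ins_row R x1" let ?R2 = "ins_row ?R1 x2"
    obtain y1 where 1: "bump N (set R) x1 y1 (set ?R1)" "ins_out R x1 = filter (\<lambda>z. z < N) [y1]"
      "sorted_wrt (<) ?R1" "reduced_word (?R1 @ [x2, x3])" "\<forall>z\<in>set (?R1 @ [x2, x3]). z < N"
      using *[OF assms] by blast
    obtain y2 where 2: "bump N (set ?R1) x2 y2 (set ?R2)" "ins_out ?R1 x2 = filter (\<lambda>z. z < N) [y2]"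
      "sorted_wrt (<) ?R2" "reduced_word (?R2 @ [x3])" "\<forall>z\<in>set (?R2 @ [x3]). z < N"
      using *[OF 1(3-5)] by blast
    obtain y3 where 3: "bump N (set ?R2) x3 y3 (set (ins_row ?R2 x3))"
      "ins_out ?R2 x3 = filter (\<lambda>z. z < N) [y3]"
      using *[OF 2(3-5)] by blast
    have "word_out R [x1, x2, x3] = filter (\<lambda>z. z < N) [y1, y2, y3]"
      using 1(2) 2(2) 3(2) by simp
    then show ?thesis
      using 1(1) 2(1) 3(1) by (metis word_row.simps)
  qed
qed

lemma word_ins_ck_move:
  assumes "ck_move u v" "sorted_wrt (<) R" "reduced_word (R @ u)"
  shows "word_row R u = word_row R v \<and> coxeter_knuth (word_out R u) (word_out R v)"
proof -
  \<comment> \<open>Any value above all letters of the row and the word can serve as the formal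
    letter.\<close>
  define N where "N = Suc (Max (set (R @ u)))"
  have N: "\<forall>z\<in>set (R @ u). z < N"
    by (auto simp: N_def less_Suc_eq_le)
  have red: "reduced_word (R @ v)"
    using ck_reduced_word[OF ck_move_imp_ck[OF assms(1)], of R "[]"] assms(3) by simp
  have Nv: "\<forall>z\<in>set (R @ v). z < N"
    using N ck_move_word(3)[OF assms(1)] by simp
  have "set (word_row R u) = set (word_row R v) \<and> coxeter_knuth (word_out R u) (word_out R v)"
    using assms(1)
  proof cases
    case (1 a b c)
    obtain y1 y2 y3 R1 R2 where R: "bump N (set R) a y1 R1" "bump N R1 c y2 R2"
      "bump N R2 b y3 (set (word_row R u))" and y: "word_out R u = filter (\<lambda>z. z < N) [y1, y2, y3]"
      using word_ins_three_bumps[OF assms(2), of a c b N] assms(3) N unfolding 1 by blast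
    obtain z1 z2 z3 S1 S2 where S: "bump N (set R) c z1 S1" "bump N S1 a z2 S2"
      "bump N S2 b z3 (set (word_row R v))" and z: "word_out R v = filter (\<lambda>z. z < N) [z1, z2, z3]"
      using word_ins_three_bumps[OF assms(2), of c a b N] red Nv unfolding 1 by blast
    have "set (word_row R u) = set (word_row R v) \<and> coxeter_knuth_below N [y1, y2, y3] [z1, z2, z3]"
      by (rule bump_knuth1[OF 1(3,4) R S])
    then show ?thesis
      unfolding y z coxeter_knuth_below_def .
  next
    case (2 a b c)
    obtain y1 y2 y3 R1 R2 where R: "bump N (set R) b y1 R1" "bump N R1 a y2 R2"
      "bump N R2 c y3 (set (word_row R u))" and y: "word_out R u = filter (\<lambda>z. z < N) [y1, y2, y3]"
      using word_ins_three_bumps[OF assms(2), of b a c N] assms(3) N unfolding 2 by blast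
    obtain z1 z2 z3 S1 S2 where S: "bump N (set R) b z1 S1" "bump N S1 c z2 S2"
      "bump N S2 a z3 (set (word_row R v))" and z: "word_out R v = filter (\<lambda>z. z < N) [z1, z2, z3]"
      using word_ins_three_bumps[OF assms(2), of b c a N] red Nv unfolding 2 by blast
    have "set (word_row R u) = set (word_row R v) \<and> coxeter_knuth_below N [y1, y2, y3] [z1, z2, z3]"
      by (rule bump_knuth2[OF 2(3,4) R S])
    then show ?thesis
      unfolding y z coxeter_knuth_below_def .
  next
    case (3 x)
    obtain y1 y2 y3 R1 R2 where R: "bump N (set R) x y1 R1" "bump N R1 (Suc x) y2 R2"
      "bump N R2 x y3 (set (word_row R u))" and y: "word_out R u = filter (\<lambda>z. z < N) [y1, y2, y3]"
      using word_ins_three_bumps[OF assms(2), of x "Suc x" x N] assms(3) N unfolding 3 by blast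
    obtain z1 z2 z3 S1 S2 where S: "bump N (set R) (Suc x) z1 S1" "bump N S1 x z2 S2"
      "bump N S2 (Suc x) z3 (set (word_row R v))" and z: "word_out R v = filter (\<lambda>z. z < N) [z1, z2, z3]"
      using word_ins_three_bumps[OF assms(2), of "Suc x" x "Suc x" N] red Nv unfolding 3 by blast
    have "set (word_row R u) = set (word_row R v) \<and> coxeter_knuth_below N [y1, y2, y3] [z1, z2, z3]"
      by (rule bump_braid[OF R S])
    then show ?thesis
      unfolding y z coxeter_knuth_below_def .
  qed
  then show ?thesis
    using sorted_word_row[OF assms(2)] strict_sorted_equal by blast
qed

lemma word_ins_ck:
  assumes "coxeter_knuth u v" "sorted_wrt (<) R" "reduced_word (R @ u)"
  shows "word_row R u = word_row R v \<and> coxeter_knuth (word_out R u) (word_out R v)"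
  using assms
proof (induction rule: coxeter_knuth.induct)
  case (ck_step u v p q)
  let ?P = "word_row R p"
  have "reduced_word (R @ p)"
    using ck_step.prems(2) reduced_word_factor[of "[]" "R @ p" "u @ q"] by simp
  \<comment> \<open>Inserting the prefix \<open>p\<close> first reduces a move in context to a move
    inserted into the row \<open>?P\<close>; afterwards both sides insert \<open>q\<close> into the
    same row.\<close>
  then have "reduced_word ([] @ (word_out R p @ ?P) @ u @ q)"
    using ck_reduced_word[OF ck_word_ins[OF ck_step.prems(1)], of p "[]" "u @ q"] ck_step.prems(2) by simp
  then have "reduced_word (?P @ u)"
    using reduced_word_factor[of "word_out R p" "?P @ u" q] by simp
  then have *: "word_row ?P u = word_row ?P v" "coxeter_knuth (word_out ?P u) (word_out ?P v)"
    using word_ins_ck_move[OF ck_step.hyps] sorted_word_row ck_step.prems by blast+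
  then show ?case
    using ck_context[OF *(2), of "word_out R p" "word_out (word_row ?P v) q"]
    by (simp add: word_row_append word_out_append)
next
  case (ck_sym u v)
  then have "reduced_word (R @ u)"
    using ck_reduced_word[of v u R "[]"] coxeter_knuth.ck_sym by simp
  with ck_sym show ?case by (simp add: coxeter_knuth.ck_sym)
next
  case (ck_trans u v w)
  then have "reduced_word (R @ v)"
    using ck_reduced_word[of u v R "[]"] by simp
  with ck_trans show ?case by (auto intro: coxeter_knuth.ck_trans)
qed (simp add: coxeter_knuth.ck_refl)

section \<open>Inserting an increasing word into a row, and two-row tableaux\<close>

lemma word_row_Cons:
  assumes "\<forall>z\<in>set u. a < z"
  shows "word_row (a # R) u = a # word_row R u" "word_out (a # R) u = word_out R u"
  using assms by (induction u arbitrary: R) auto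

lemma word_row_nil: "sorted_wrt (<) u \<Longrightarrow> word_row [] u = u"
  by (induction u) (auto simp: word_row_Cons)

lemma word_out_nil: "sorted_wrt (<) u \<Longrightarrow> word_out [] u = []"
  by (induction u) (auto simp: word_row_Cons)

text \<open>In each case the head of the resulting row is smaller than every letter still to be
  inserted, so it is final. Insertion of one row into another thus becomes a recursion on both
  rows.\<close>

lemma word_ins_Cons:
  assumes "sorted_wrt (<) (s # \<sigma>)"
  shows "s < t \<Longrightarrow> word_row (t # \<tau>) (s # \<sigma>) = s # word_row \<tau> \<sigma>"
    "s < t \<Longrightarrow> word_out (t # \<tau>) (s # \<sigma>) = t # word_out \<tau> \<sigma>"
    "t < s \<Longrightarrow> word_row (t # \<tau>) (s # \<sigma>) = t # word_row \<tau> (s # \<sigma>)"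
    "t < s \<Longrightarrow> word_out (t # \<tau>) (s # \<sigma>) = word_out \<tau> (s # \<sigma>)"
    "s = t \<Longrightarrow> word_row (t # \<tau>) (s # \<sigma>) = t # word_row \<tau> \<sigma>"
    "s = t \<Longrightarrow> word_out (t # \<tau>) (s # \<sigma>) = Suc t # word_out \<tau> \<sigma>"
proof -
  have "\<forall>z\<in>set (s # \<sigma>). t < z" if "t < s"
    using assms that by auto
  then show "t < s \<Longrightarrow> word_row (t # \<tau>) (s # \<sigma>) = t # word_row \<tau> (s # \<sigma>)"
    "t < s \<Longrightarrow> word_out (t # \<tau>) (s # \<sigma>) = word_out \<tau> (s # \<sigma>)"
    using word_row_Cons by blast+
qed (use assms in \<open>auto simp: word_row_Cons\<close>)

declare word_row.simps(2) [simp del] word_out.simps(2) [simp del]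

text \<open>A two-row tableau with the larger entries on top; that the rows increase is always
  stated separately.\<close>

fun tableau :: "nat list \<Rightarrow> nat list \<Rightarrow> bool" where
  "tableau [] S \<longleftrightarrow> True"
| "tableau (t # T) [] \<longleftrightarrow> False"
| "tableau (t # T) (s # S) \<longleftrightarrow> s < t \<and> tableau T S"

lemma tableau_ins:
  assumes "tableau T S" "sorted_wrt (<) S"
  shows "word_row T S = S" "word_out T S = T"
  using assms by (induction T S rule: tableau.induct)
    (auto simp: word_row_nil word_out_nil word_ins_Cons)

text \<open>A new first entry moves the lower row one column to the right, which only makes the
  entries below \<open>T\<close> smaller. This is the situation when the head of a row is below all
  inserted letters and stays put.\<close>

lemma tableau_Cons: "tableau T S \<Longrightarrow> sorted_wrt (<) (s # S) \<Longrightarrow> tableau T (s # S)"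
proof (induction T S arbitrary: s rule: tableau.induct)
  case (3 t T s' S)
  then show ?case by (cases S) auto
qed auto

lemma tableau_tl: "tableau T (s # S) \<Longrightarrow> tableau (tl T) S"
  by (cases T) auto

text \<open>Induction following the comparison of heads in \<open>word_ins_Cons\<close>.\<close>

lemma word_ins_induct [consumes 1, case_names Nil_row Nil_word less greater equal]:
  fixes \<tau> \<sigma> :: "nat list"
  assumes "sorted_wrt (<) \<sigma>"
    and "\<And>\<sigma>. sorted_wrt (<) \<sigma> \<Longrightarrow> P [] \<sigma>" "\<And>t \<tau>. P (t # \<tau>) []"
    and "\<And>t \<tau> s \<sigma>. sorted_wrt (<) (s # \<sigma>) \<Longrightarrow> s < t \<Longrightarrow> P \<tau> \<sigma> \<Longrightarrow> P (t # \<tau>) (s # \<sigma>)"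
    and "\<And>t \<tau> s \<sigma>. sorted_wrt (<) (s # \<sigma>) \<Longrightarrow> t < s \<Longrightarrow> P \<tau> (s # \<sigma>) \<Longrightarrow> P (t # \<tau>) (s # \<sigma>)"
    and "\<And>t \<tau> \<sigma>. sorted_wrt (<) (t # \<sigma>) \<Longrightarrow> P \<tau> \<sigma> \<Longrightarrow> P \<tau> (t # \<sigma>) \<Longrightarrow> P (t # \<tau>) (t # \<sigma>)"
  shows "P \<tau> \<sigma>"
  using assms(1)
proof (induction \<tau> arbitrary: \<sigma>)
  case (Cons t \<tau>)
  show ?case
  proof (cases \<sigma>)
    case (Cons s \<sigma>')
    then show ?thesis
      using assms(4-6) Cons.IH Cons.prems by (cases rule: linorder_cases[of s t]) auto
  qed (simp add: assms(3))
qed (rule assms(2))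

text \<open>A bumped letter exceeds the letter that bumps it. The sharp bound \<open>Suc m\<close>
  serves \<open>sorted_word_out\<close> in the case of equal heads, where \<open>Suc t\<close>
  itself has just been put out.\<close>

lemma word_out_greater:
  assumes "sorted_wrt (<) R" "sorted_wrt (<) u" "\<forall>z\<in>set u. m < z"
  shows "\<forall>y\<in>set (word_out R u). Suc m < y"
  using assms(2,1,3) by (induction R u rule: word_ins_induct)
    (auto simp: word_out_nil word_ins_Cons)

lemma word_out_greater_row:
  assumes "sorted_wrt (<) u" "\<forall>z\<in>set R. m < z"
  shows "\<forall>y\<in>set (word_out R u). m < y"
  using assms by (induction R u rule: word_ins_induct) (auto simp: word_out_nil word_ins_Cons)

lemma sorted_word_out:
  assumes "sorted_wrt (<) R" "sorted_wrt (<) u"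
  shows "sorted_wrt (<) (word_out R u)"
  using assms(2,1)
proof (induction R u rule: word_ins_induct)
  case (less t \<tau> s \<sigma>)
  have "\<forall>y\<in>set (word_out \<tau> \<sigma>). t < y"
    using word_out_greater_row[of \<sigma> \<tau> t] less by simp
  then show ?case
    using less by (auto simp: word_ins_Cons)
next
  case (equal t \<tau> \<sigma>)
  then show ?case
    using word_out_greater[of \<tau> \<sigma> t] by (auto simp: word_ins_Cons)
qed (auto simp: word_out_nil word_ins_Cons)

lemma tableau_word_ins:
  assumes "sorted_wrt (<) \<tau>" "sorted_wrt (<) \<sigma>"
  shows "tableau (word_out \<tau> \<sigma>) (word_row \<tau> \<sigma>)"
  using assms(2,1)
proof (induction \<tau> \<sigma> rule: word_ins_induct)
  case (greater t \<tau> s \<sigma>)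
  have "sorted_wrt (<) (t # word_row \<tau> (s # \<sigma>))"
    using sorted_word_row[of "t # \<tau>" "s # \<sigma>"] greater by (simp only: word_ins_Cons)
  then show ?case
    using greater tableau_Cons by (simp add: word_ins_Cons)
qed (auto simp: word_out_nil word_ins_Cons)

section \<open>The letters bumped by the two rows of a tableau\<close>

text \<open>As \<open>c\<close> increases, only its first letter can affect the head
  \<open>x\<close>; all later letters exceed whatever head that leaves.\<close>

lemma word_out_Cons_cases:
  assumes "sorted_wrt (<) c"
  obtains "word_out (x # R) c = word_out R c"
  | \<gamma> c' y where "c = \<gamma> # c'" "sorted_wrt (<) c'" "y = x \<or> y = Suc x" "word_out (x # R) c = y # word_out R c'"
proof (cases c)
  case Nil
  then show ?thesis using that(1) by simp
next
  case (Cons \<gamma> c')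
  have c': "sorted_wrt (<) c'"
    using assms Cons by simp
  consider "\<gamma> < x" | "\<gamma> = x" | "x < \<gamma>" by linarith
  then show ?thesis
  proof cases
    case 1
    then show ?thesis
      using that(2)[OF Cons c', of x] assms unfolding Cons by (simp add: word_ins_Cons)
  next
    case 2
    then show ?thesis
      using that(2)[OF Cons c', of "Suc x"] assms unfolding Cons by (simp add: word_ins_Cons)
  next
    case 3
    then show ?thesis
      using that(1) assms unfolding Cons by (simp add: word_ins_Cons)
  qed
qed

lemma tableau_drop_tl:
  "tableau (drop n b) (\<gamma> # c) \<Longrightarrow> tableau (drop (Suc n) b) c"
  using tableau_tl[of "drop n b" \<gamma> c] by (simp add: tl_drop drop_Suc)

text \<open>The case rule for passing a head \<open>x\<close> in the induction below. The word
  \<open>E\<close>, of at most one letter, is what \<open>c\<close> bumps there; each letter of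
  \<open>c\<close> used up moves \<open>c\<close> one more column ahead of \<open>b\<close>, whence
  the growing argument of \<open>drop\<close>.\<close>

lemma tableau_word_out_Cons:
  assumes c: "sorted_wrt (<) c" "tableau (drop n b) c"
    and *: "\<And>E c'. set E \<subseteq> {x, Suc x} \<Longrightarrow> sorted_wrt (<) c' \<Longrightarrow> tableau (drop (n + length E) b) c' \<Longrightarrow>
      tableau T (D @ E @ word_out R c')"
  shows "tableau T (D @ word_out (x # R) c)"
  using c(1)
proof (cases rule: word_out_Cons_cases[of c x R])
  case 1
  then show ?thesis
    using *[of "[]" c] c by simp
next
  case (2 \<gamma> c' y)
  then show ?thesis
    using *[of "[y]" c'] c tableau_drop_tl[of n b \<gamma> c'] by simp
qed

text \<open>\<open>D\<close> holds letters bumped by letters of the lower row in columns already passed: a letter of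
  \<open>c\<close> may act in an earlier column than the letter of \<open>b\<close> above it, never in a later one.\<close>

lemma tableau_word_out:
  assumes "sorted_wrt (<) b" "sorted_wrt (<) c" "tableau (drop (length D) b) c"
    and "\<forall>d\<in>set D. \<forall>z\<in>set b. d \<le> z"
  shows "tableau (word_out A b) (D @ word_out (word_row A b) c)"
  using assms
proof (induction A b arbitrary: D c rule: word_ins_induct)
  case (Nil_row b)
  then show ?case by (simp add: word_out_nil)
next
  case (Nil_word t \<tau>)
  then show ?case by simp
next
  case (less a A \<beta> b)
  \<comment> \<open>The letters of \<open>b\<close> exceed \<beta>, so the bound \<open>Suc\<close>
    \<beta> is enough for the waiting letters.\<close>
  have IH: "tableau (word_out A b) (D' @ word_out (word_row A b) c')"
    if "sorted_wrt (<) c'" "tableau (drop (length D') b) c'" "\<forall>d\<in>set D'. d \<le> Suc \<beta>" for D' c'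
    using less.IH[of c' D'] that less.hyps by fastforce
  show ?case
  proof (cases D)
    case Nil
    then obtain \<gamma> c1 where c: "c = \<gamma> # c1" "\<gamma> < \<beta>" "tableau b c1"
      using less.prems(2) by (cases c) auto
    then show ?thesis
      using Nil less.prems less.hyps IH[of c1 "[]"] by (simp add: word_ins_Cons)
  next
    \<comment> \<open>The waiting letter \<open>d\<close> takes the place below \<open>a\<close>,
      and what \<open>c\<close> bumps from the head \<beta> joins the queue.\<close>
    case (Cons d D1)
    have D1: "\<forall>d\<in>set D1. d \<le> Suc \<beta>"
      using less.prems(3) by (simp add: Cons le_SucI)
    have "tableau (word_out A b) (D1 @ word_out (\<beta> # word_row A b) c)"
    proof (rule tableau_word_out_Cons[OF less.prems(1), of "length D1" b])
      show "tableau (drop (length D1) b) c"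
        using less.prems(2) Cons by simp
      fix E c' assume "set E \<subseteq> {\<beta>, Suc \<beta>}" "sorted_wrt (<) c'" "tableau (drop (length D1 + length E) b) c'"
      then show "tableau (word_out A b) (D1 @ E @ word_out (word_row A b) c')"
        using IH[of c' "D1 @ E"] D1 by fastforce
    qed
    then show ?thesis
      using less.prems(3) less.hyps by (simp add: Cons word_ins_Cons)
  qed
next
  \<comment> \<open>The upper row receives no letter here, so anything that \<open>c\<close> bumps
    from \<open>a\<close> has to wait; it is at most \<open>Suc a\<close>, hence at most
    \<beta>.\<close>
  case (greater a A \<beta> b)
  have "tableau (word_out A (\<beta> # b)) (D @ word_out (a # word_row A (\<beta> # b)) c)"
  proof (rule tableau_word_out_Cons[OF greater.prems(1,2)])
    fix E c' assume "set E \<subseteq> {a, Suc a}" "sorted_wrt (<) c'" "tableau (drop (length D + length E) (\<beta> # b)) c'"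
    then show "tableau (word_out A (\<beta> # b)) (D @ E @ word_out (word_row A (\<beta> # b)) c')"
      using greater.IH[of c' "D @ E"] greater.prems(3) greater.hyps by fastforce
  qed
  then show ?case
    using greater.hyps by (simp add: word_ins_Cons)
next
  case (equal a A b)
  have IH: "tableau (word_out A b) (D' @ word_out (word_row A b) c')"
    if "sorted_wrt (<) c'" "tableau (drop (length D') b) c'" "\<forall>d\<in>set D'. d \<le> Suc a" for D' c'
    using equal.IH(1)[of c' D'] that equal.hyps by fastforce
  show ?case
  proof (cases D)
    case Nil
    then obtain \<gamma> c1 where c: "c = \<gamma> # c1" "\<gamma> < a" "tableau b c1"
      using equal.prems(2) by (cases c) auto
    then show ?thesis
      using Nil equal.prems equal.hyps IH[of c1 "[]"] by (simp add: word_ins_Cons)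
  next
    case (Cons d D1)
    have D1: "\<forall>d\<in>set D1. d \<le> Suc a"
      using equal.prems(3) by (simp add: Cons le_SucI)
    have "tableau (word_out A b) (D1 @ word_out (a # word_row A b) c)"
    proof (rule tableau_word_out_Cons[OF equal.prems(1), of "length D1" b])
      show "tableau (drop (length D1) b) c"
        using equal.prems(2) Cons by simp
      fix E c' assume "set E \<subseteq> {a, Suc a}" "sorted_wrt (<) c'" "tableau (drop (length D1 + length E) b) c'"
      then show "tableau (word_out A b) (D1 @ E @ word_out (word_row A b) c')"
        using IH[of c' "D1 @ E"] D1 by fastforce
    qed
    then show ?thesis
      using equal.prems(3) equal.hyps by (simp add: Cons word_ins_Cons)
  qed
qed

section \<open>The braid relation for row insertion\<close>

lemma word_ins_braid:
  assumes rows: "sorted_wrt (<) A" "sorted_wrt (<) B" "sorted_wrt (<) C"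
    and red: "reduced_word (A @ B @ C)"
    and b: "b = word_out B C" "c = word_row B C"
    and l: "A1 = word_out A b" "b1 = word_row A b" "b2 = word_out b1 c" "c2 = word_row b1 c"
    and r: "B1 = word_out A B" "r1 = word_row A B" "B2 = word_out r1 C" "r2 = word_row r1 C"
  shows "A1 = word_out B1 B2" "b2 = word_row B1 B2" "c2 = r2"
proof -
  have BC: "coxeter_knuth (B @ C) (b @ c)"
    using ck_word_ins[of B C] rows red reduced_word_factor[of A "B @ C" "[]"] unfolding b by simp
  have sorted: "sorted_wrt (<) b" "sorted_wrt (<) c" "sorted_wrt (<) A1" "sorted_wrt (<) b1" "sorted_wrt (<) b2"
    "sorted_wrt (<) B1" "sorted_wrt (<) r1" "sorted_wrt (<) B2"
    using rows sorted_word_out sorted_word_row unfolding b l r by blast+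
  have 1: "word_row A (B @ C) = word_row A (b @ c)" "coxeter_knuth (word_out A (B @ C)) (word_out A (b @ c))"
    using word_ins_ck[OF BC] rows red by auto
  then show "c2 = r2"
    by (simp add: word_row_append l r)
  have 2: "coxeter_knuth (B1 @ B2) (A1 @ b2)"
    using 1(2) by (simp add: word_out_append l r)
  \<comment> \<open>The bumped word is itself reduced, as a factor of a word equivalent to
    \<open>A @ B @ C\<close>; this permits inserting it into an empty row to obtain the next row of
    the insertion tableau.\<close>
  have "reduced_word ([] @ word_out A (B @ C) @ word_row A (B @ C))"
    using ck_reduced_word[OF ck_word_ins[of A "B @ C"], of "[]" "[]"] rows(1) red by simp
  then have "reduced_word ([] @ B1 @ B2)"
    using reduced_word_factor[of "[]" "B1 @ B2" "word_row A (B @ C)"] by (simp add: word_out_append r)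
  then have 3: "word_row [] (B1 @ B2) = word_row [] (A1 @ b2)"
      "coxeter_knuth (word_out [] (B1 @ B2)) (word_out [] (A1 @ b2))" "reduced_word (word_out [] (B1 @ B2))"
    using word_ins_ck[OF 2, of "[]"] ck_reduced_word[OF ck_word_ins[of "[]" "B1 @ B2"], of "[]" "[]"]
      reduced_word_factor[of "[]" "word_out [] (B1 @ B2)"] by auto
  \<comment> \<open>Here it matters that \<open>b\<close> over \<open>c\<close> is a tableau: the
    insertion of \<open>b2\<close> into \<open>A1\<close> is then already trivial.\<close>
  have tab: "tableau A1 b2"
    using tableau_word_out[of b c "[]" A] sorted tableau_word_ins[of B C] rows unfolding l b by simp
  then have "word_row A1 b2 = b2" "word_out A1 b2 = A1"
    using tableau_ins sorted by blast+
  then have 4: "word_row [] (A1 @ b2) = b2" "word_out [] (A1 @ b2) = A1"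
    using sorted by (simp_all add: word_row_append word_out_append word_row_nil word_out_nil)
  have 5: "word_row [] (B1 @ B2) = word_row B1 B2" "word_out [] (B1 @ B2) = word_out B1 B2"
    using sorted by (simp_all add: word_row_append word_out_append word_row_nil word_out_nil)
  show "b2 = word_row B1 B2"
    using 3(1) unfolding 4 5 by simp
  \<comment> \<open>Equivalent words may differ, but both of these are increasing, and inserting an
    increasing word into the empty row gives it back.\<close>
  have "coxeter_knuth (word_out B1 B2) A1" "reduced_word (word_out B1 B2)"
    using 3(2,3) unfolding 4 5 by simp_all
  then have "word_row [] (word_out B1 B2) = word_row [] A1"
    using word_ins_ck[of "word_out B1 B2" A1 "[]"] by simp
  then show "A1 = word_out B1 B2"
    using sorted sorted_word_out by (simp add: word_row_nil)
qed

section \<open>The drop alignment, one column at a time\<close>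

lemma align_cols_Nil: "align_cols [] \<sigma> = [0..<length \<sigma>]" "align_cols \<tau> [] = []"
  by (simp_all add: align_cols.simps)

text \<open>The definition handles a whole run of columns up to the next gap. A filled first column
  lengthens that run by one, so the least bad index moves by one while the recursive call stays the
  same.\<close>

lemma align_cols_less:
  assumes "s < t"
  shows "align_cols (t # \<tau>) (s # \<sigma>) = 0 # map Suc (align_cols \<tau> \<sigma>)"
proof -
  let ?P = "\<lambda>\<tau> \<sigma> j. j < min (length \<sigma>) (length \<tau>) \<and> \<tau> ! j \<le> \<sigma> ! j"
  have all: "(\<forall>j<min (length \<sigma>) (length \<tau>). \<sigma> ! j < \<tau> ! j) \<longleftrightarrow> (\<nexists>j. ?P \<tau> \<sigma> j)" for \<tau> \<sigma> :: "nat list"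
    by (auto simp: not_le)
  have Suc: "?P (t # \<tau>) (s # \<sigma>) (Suc j) \<longleftrightarrow> ?P \<tau> \<sigma> j" for j
    by simp
  have ex: "(\<exists>j. ?P (t # \<tau>) (s # \<sigma>) j) \<longleftrightarrow> (\<exists>j. ?P \<tau> \<sigma> j)"
    using assms Suc by (metis linorder_not_le nth_Cons_0 not0_implies_Suc)
  show ?thesis
  proof (cases "\<exists>j. ?P \<tau> \<sigma> j")
    case False
    then have "align_cols (t # \<tau>) (s # \<sigma>) = [0..<Suc (length \<sigma>)]" "align_cols \<tau> \<sigma> = [0..<length \<sigma>]"
      using False ex unfolding align_cols.simps[of "t # \<tau>"] align_cols.simps[of \<tau>] all by auto
    then show ?thesis
      by (simp only: upt_conv_Cons zero_less_Suc map_Suc_upt)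
  next
    case True
    let ?j = "LEAST j. ?P \<tau> \<sigma> j"
    obtain j0 where j0: "?P \<tau> \<sigma> j0"
      using True by blast
    have least: "(LEAST j. ?P (t # \<tau>) (s # \<sigma>) j) = Suc ?j"
      using Least_Suc[of "?P (t # \<tau>) (s # \<sigma>)" "Suc j0"] j0 assms by simp
    have tau: "align_cols \<tau> \<sigma> =
        [0..<?j] @ map (\<lambda>c. c + (?j + 1)) (align_cols (drop (?j + 1) \<tau>) (drop ?j \<sigma>))"
      using True unfolding align_cols.simps[of \<tau>] all by (simp add: Let_def)
    have "align_cols (t # \<tau>) (s # \<sigma>) =
        [0..<Suc ?j] @ map (\<lambda>c. c + (Suc ?j + 1)) (align_cols (drop (?j + 1) \<tau>) (drop ?j \<sigma>))"
      using True ex unfolding align_cols.simps[of "t # \<tau>"] all least Let_def by simp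
    also have "[0..<Suc ?j] = 0 # map Suc [0..<?j]"
      by (simp only: upt_conv_Cons zero_less_Suc map_Suc_upt)
    finally show ?thesis
      unfolding tau by (simp add: comp_def)
  qed
qed

lemma align_cols_gap:
  assumes "\<sigma> = [] \<or> t \<le> hd \<sigma>"
  shows "align_cols (t # \<tau>) \<sigma> = map Suc (align_cols \<tau> \<sigma>)"
proof (cases \<sigma>)
  case (Cons s \<sigma>')
  have least: "(LEAST j. j < min (length \<sigma>) (length (t # \<tau>)) \<and> (t # \<tau>) ! j \<le> \<sigma> ! j) = 0"
    using assms by (intro Least_equality) (auto simp: Cons)
  have "\<not> (\<forall>j<min (length \<sigma>) (length (t # \<tau>)). \<sigma> ! j < (t # \<tau>) ! j)"
    using assms by (auto simp: Cons)
  then have "align_cols (t # \<tau>) \<sigma> =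
      [0..<0] @ map (\<lambda>c. c + (0 + 1)) (align_cols (drop (0 + 1) (t # \<tau>)) (drop 0 \<sigma>))"
    unfolding align_cols.simps[of "t # \<tau>"] least Let_def by (rule if_not_P)
  then show ?thesis by simp
qed (simp add: align_cols_Nil)

lemma upt_Suc_length: "[0..<length (t # \<tau>)] = 0 # map Suc [0..<length \<tau>]"
  by (simp only: length_Cons upt_conv_Cons zero_less_Suc map_Suc_upt)

lemma gaps_less: "s < t \<Longrightarrow> gaps (t # \<tau>) (s # \<sigma>) = map Suc (gaps \<tau> \<sigma>)"
  unfolding gaps_def align_cols_less upt_Suc_length by (simp add: filter_map comp_def inj_image_mem_iff)

lemma gaps_gap: "\<sigma> = [] \<or> t \<le> hd \<sigma> \<Longrightarrow> gaps (t # \<tau>) \<sigma> = 0 # map Suc (gaps \<tau> \<sigma>)"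
  unfolding gaps_def align_cols_gap upt_Suc_length by (simp add: filter_map comp_def inj_image_mem_iff)

section \<open>Recursion for \<open>drop_pair\<close> on the top row\<close>

text \<open>Isolates the dependence of a shifted block on its gap letter and its two factors, so
  that blocks of different pairs of rows can be compared.\<close>

definition hat :: "nat \<Rightarrow> nat list \<Rightarrow> nat list \<Rightarrow> nat list" where
  "hat x T S =
    (let b = (if T \<noteq> [] \<and> T ! 0 = x + 1
        then Max {b. b \<le> length T \<and> (\<forall>i\<in>{1..b}. T ! (i - 1) = S ! 0 + i)} else 0)
     in map (\<lambda>i. if i < b then S ! i + 1 else S ! i) [0..<length S])"

lemma hat_block_eq: "hat_block \<tau> \<sigma> j = hat (gap_letter \<tau> \<sigma> j) (top_block \<tau> \<sigma> j) (bottom_block \<tau> \<sigma> j)"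
  by (simp add: hat_block_def hat_def shift_len_def Let_def)

lemma hat_id: "T = [] \<or> T ! 0 \<noteq> Suc x \<Longrightarrow> hat x T S = S"
  by (auto simp: hat_def map_nth)

text \<open>After raising the first \<open>t\<close>, the rest of the block is shifted as if
  \<open>Suc t\<close> were a gap letter in front of it: a run continuing into \<open>T\<close> is
  one longer than the run counted from there.\<close>

lemma hat_Cons:
  assumes "T \<noteq> [] \<Longrightarrow> S \<noteq> [] \<and> t < S ! 0 \<and> S ! 0 < T ! 0"
  shows "hat t (Suc t # T) (t # S) = Suc t # hat (Suc t) T S"
proof -
  define B where "B = {b. b \<le> length T \<and> (\<forall>i\<in>{1..b}. T ! (i - 1) = S ! 0 + i)}"
  define B' where "B' = {b. b \<le> Suc (length T) \<and> (\<forall>i\<in>{1..b}. (Suc t # T) ! (i - 1) = t + i)}"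
  have fin: "finite B" "finite B'" "0 \<in> B"
    by (auto simp: B_def B'_def)
  have Max: "Max B' = Suc (if T \<noteq> [] \<and> T ! 0 = Suc (Suc t) then Max B else 0)"
  proof (cases "T \<noteq> [] \<and> T ! 0 = Suc (Suc t)")
    case True
    \<comment> \<open>The first letter of \<open>S\<close> is squeezed between t and t+2, so both
      counts of the run refer to the same values.\<close>
    then have S: "S ! 0 = Suc t"
      using assms by auto
    have "Suc b \<in> B' \<longleftrightarrow> b \<in> B" for b
    proof -
      have *: "{1..Suc b} = insert 1 (Suc ` {1..b})"
        by auto
      have "(\<forall>i\<in>{1..Suc b}. (Suc t # T) ! (i - 1) = t + i) \<longleftrightarrow> (\<forall>i\<in>{1..b}. T ! (i - 1) = Suc t + i)"
        unfolding * ball_simps by simp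
      then show ?thesis
        by (simp add: B_def B'_def S)
    qed
    moreover have "0 \<in> B'" by (simp add: B'_def)
    ultimately have "b \<in> B' \<longleftrightarrow> b \<in> insert 0 (Suc ` B)" for b
      by (cases b) auto
    then have "B' = insert 0 (Suc ` B)"
      by blast
    moreover have "Max (Suc ` B) = Suc (Max B)"
      using fin by (intro mono_Max_commute[symmetric]) (auto intro: monoI)
    moreover have "Max (insert 0 (Suc ` B)) = max 0 (Max (Suc ` B))"
      using fin by (intro Max_insert) auto
    ultimately show ?thesis
      using True by simp
  next
    case False
    have "b \<le> 1" if "b \<in> B'" for b
    proof (rule ccontr)
      assume "\<not> b \<le> 1"
      then have "2 \<in> {1..b}" "T \<noteq> []" using that by (auto simp: B'_def)
      then have "(Suc t # T) ! (2 - 1) = t + 2"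
        using that unfolding B'_def by blast
      then show False using False \<open>T \<noteq> []\<close> by simp
    qed
    moreover have "1 \<in> B'" by (auto simp: B'_def)
    ultimately have "Max B' = 1"
      using fin by (intro Max_eqI) auto
    then show ?thesis using False by auto
  qed
  have "hat t (Suc t # T) (t # S) =
      map (\<lambda>i. if i < Max B' then (t # S) ! i + 1 else (t # S) ! i) [0..<Suc (length S)]"
    by (simp add: hat_def B'_def)
  also have "\<dots> = Suc t # map (\<lambda>i. if Suc i < Max B' then S ! i + 1 else S ! i) [0..<length S]"
    unfolding Max by (simp add: upt_conv_Cons map_Suc_upt[symmetric] comp_def del: upt_Suc)
  also have "\<dots> = Suc t # hat (Suc t) T S"
    unfolding Max hat_def B_def by (simp add: Let_def)
  finally show ?thesis .
qed

text \<open>Block 0 is split off because a new first column affects it alone: a filled column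
  extends it, and a gap turns it into a block subject to shifting.\<close>

definition bottom_rest :: "nat list \<Rightarrow> nat list \<Rightarrow> nat list" where
  "bottom_rest \<tau> \<sigma> =
    concat (map (\<lambda>j. gap_letter \<tau> \<sigma> j # hat_block \<tau> \<sigma> j) [1..<length (gaps \<tau> \<sigma>) + 1]) @ bottom_tail \<tau> \<sigma>"

lemma drop_pair_eq:
  "drop_pair \<tau> \<sigma> =
    (concat (map (top_block \<tau> \<sigma>) [0..<length (gaps \<tau> \<sigma>) + 1]), bottom_block \<tau> \<sigma> 0 @ bottom_rest \<tau> \<sigma>)"
  by (simp add: drop_pair_def bottom_rest_def Let_def)

lemma block_bounds_less:
  assumes "s < t"
  shows "block_start (t # \<tau>) (s # \<sigma>) 0 = 0" "block_start \<tau> \<sigma> 0 = 0"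
    "\<lbrakk>1 \<le> j; j \<le> length (gaps \<tau> \<sigma>)\<rbrakk> \<Longrightarrow> block_start (t # \<tau>) (s # \<sigma>) j = Suc (block_start \<tau> \<sigma> j)"
    "j \<le> length (gaps \<tau> \<sigma>) \<Longrightarrow> block_end (t # \<tau>) (s # \<sigma>) j = Suc (block_end \<tau> \<sigma> j)"
  using assms by (auto simp: block_start_def block_end_def gaps_less)

lemma block_bounds_gap:
  assumes "\<sigma> = [] \<or> t \<le> hd \<sigma>"
  shows "block_start (t # \<tau>) \<sigma> 0 = 0" "block_end (t # \<tau>) \<sigma> 0 = 0"
    "j \<le> length (gaps \<tau> \<sigma>) \<Longrightarrow> block_start (t # \<tau>) \<sigma> (Suc j) = Suc (block_start \<tau> \<sigma> j)"
    "j \<le> length (gaps \<tau> \<sigma>) \<Longrightarrow> block_end (t # \<tau>) \<sigma> (Suc j) = Suc (block_end \<tau> \<sigma> j)"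
  using assms by (auto simp: block_start_def block_end_def gaps_gap nth_Cons')

lemma map_nth_upt_Suc: "map (\<lambda>c. (t # \<tau>) ! c) [Suc a..<Suc b] = map (\<lambda>c. \<tau> ! c) [a..<b]"
  by (simp add: map_Suc_upt[symmetric] comp_def del: upt_Suc)

lemma zip_map_Suc: "zip \<sigma> (map Suc cs) = map (\<lambda>(a, c). (a, Suc c)) (zip \<sigma> cs)"
  by (simp add: zip_map2)

lemma blocks_gap:
  assumes "\<sigma> = [] \<or> t \<le> hd \<sigma>"
  shows "top_block (t # \<tau>) \<sigma> 0 = []" "bottom_block (t # \<tau>) \<sigma> 0 = []"
    "j \<le> length (gaps \<tau> \<sigma>) \<Longrightarrow> top_block (t # \<tau>) \<sigma> (Suc j) = top_block \<tau> \<sigma> j"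
    "j \<le> length (gaps \<tau> \<sigma>) \<Longrightarrow> bottom_block (t # \<tau>) \<sigma> (Suc j) = bottom_block \<tau> \<sigma> j"
    "bottom_tail (t # \<tau>) \<sigma> = bottom_tail \<tau> \<sigma>"
    "gap_letter (t # \<tau>) \<sigma> 1 = t"
    "\<lbrakk>1 \<le> j; j \<le> length (gaps \<tau> \<sigma>)\<rbrakk> \<Longrightarrow> gap_letter (t # \<tau>) \<sigma> (Suc j) = gap_letter \<tau> \<sigma> j"
proof -
  note b = block_bounds_gap[OF assms] and a = align_cols_gap[OF assms] and g = gaps_gap[OF assms]
  show "top_block (t # \<tau>) \<sigma> 0 = []" "bottom_block (t # \<tau>) \<sigma> 0 = []"
    by (simp_all add: top_block_def bottom_block_def b)
  show "j \<le> length (gaps \<tau> \<sigma>) \<Longrightarrow> top_block (t # \<tau>) \<sigma> (Suc j) = top_block \<tau> \<sigma> j"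
    by (simp only: top_block_def b map_nth_upt_Suc)
  show "j \<le> length (gaps \<tau> \<sigma>) \<Longrightarrow> bottom_block (t # \<tau>) \<sigma> (Suc j) = bottom_block \<tau> \<sigma> j"
    by (simp add: bottom_block_def b a zip_map_Suc filter_map comp_def case_prod_unfold)
  show "bottom_tail (t # \<tau>) \<sigma> = bottom_tail \<tau> \<sigma>"
    by (simp add: bottom_tail_def a zip_map_Suc filter_map comp_def case_prod_unfold)
  show "gap_letter (t # \<tau>) \<sigma> 1 = t"
    by (simp add: gap_letter_def g)
  show "\<lbrakk>1 \<le> j; j \<le> length (gaps \<tau> \<sigma>)\<rbrakk> \<Longrightarrow> gap_letter (t # \<tau>) \<sigma> (Suc j) = gap_letter \<tau> \<sigma> j"
    by (simp add: gap_letter_def g nth_Cons')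
qed

lemma blocks_less:
  assumes "s < t"
  shows "top_block (t # \<tau>) (s # \<sigma>) 0 = t # top_block \<tau> \<sigma> 0"
    "bottom_block (t # \<tau>) (s # \<sigma>) 0 = s # bottom_block \<tau> \<sigma> 0"
    "\<lbrakk>1 \<le> j; j \<le> length (gaps \<tau> \<sigma>)\<rbrakk> \<Longrightarrow> top_block (t # \<tau>) (s # \<sigma>) j = top_block \<tau> \<sigma> j"
    "\<lbrakk>1 \<le> j; j \<le> length (gaps \<tau> \<sigma>)\<rbrakk> \<Longrightarrow> bottom_block (t # \<tau>) (s # \<sigma>) j = bottom_block \<tau> \<sigma> j"
    "bottom_tail (t # \<tau>) (s # \<sigma>) = bottom_tail \<tau> \<sigma>"
    "\<lbrakk>1 \<le> j; j \<le> length (gaps \<tau> \<sigma>)\<rbrakk> \<Longrightarrow> gap_letter (t # \<tau>) (s # \<sigma>) j = gap_letter \<tau> \<sigma> j"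
proof -
  note b = block_bounds_less[OF assms] and a = align_cols_less[OF assms] and g = gaps_less[OF assms]
  have "[0..<Suc n] = 0 # [Suc 0..<Suc n]" for n
    by (rule upt_conv_Cons) simp
  then show "top_block (t # \<tau>) (s # \<sigma>) 0 = t # top_block \<tau> \<sigma> 0"
    by (simp add: top_block_def b map_nth_upt_Suc del: upt_Suc)
  show "bottom_block (t # \<tau>) (s # \<sigma>) 0 = s # bottom_block \<tau> \<sigma> 0"
    by (simp add: bottom_block_def b a zip_map_Suc filter_map comp_def case_prod_unfold)
  show "\<lbrakk>1 \<le> j; j \<le> length (gaps \<tau> \<sigma>)\<rbrakk> \<Longrightarrow> top_block (t # \<tau>) (s # \<sigma>) j = top_block \<tau> \<sigma> j"
    by (simp only: top_block_def b map_nth_upt_Suc)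
  show "\<lbrakk>1 \<le> j; j \<le> length (gaps \<tau> \<sigma>)\<rbrakk> \<Longrightarrow> bottom_block (t # \<tau>) (s # \<sigma>) j = bottom_block \<tau> \<sigma> j"
    by (simp add: bottom_block_def b a zip_map_Suc filter_map comp_def case_prod_unfold)
  show "bottom_tail (t # \<tau>) (s # \<sigma>) = bottom_tail \<tau> \<sigma>"
    by (simp add: bottom_tail_def a zip_map_Suc filter_map comp_def case_prod_unfold)
  show "\<lbrakk>1 \<le> j; j \<le> length (gaps \<tau> \<sigma>)\<rbrakk> \<Longrightarrow> gap_letter (t # \<tau>) (s # \<sigma>) j = gap_letter \<tau> \<sigma> j"
    by (simp add: gap_letter_def g)
qed

lemma bottom_rest_less:
  assumes "s < t"
  shows "bottom_rest (t # \<tau>) (s # \<sigma>) = bottom_rest \<tau> \<sigma>"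
proof -
  have "map (\<lambda>j. gap_letter (t # \<tau>) (s # \<sigma>) j # hat_block (t # \<tau>) (s # \<sigma>) j) [1..<length (gaps \<tau> \<sigma>) + 1] =
      map (\<lambda>j. gap_letter \<tau> \<sigma> j # hat_block \<tau> \<sigma> j) [1..<length (gaps \<tau> \<sigma>) + 1]"
    by (rule map_cong) (auto simp: hat_block_eq blocks_less[OF assms] simp del: upt_Suc)
  then show ?thesis
    by (simp only: bottom_rest_def blocks_less[OF assms] gaps_less[OF assms] length_map)
qed

lemma bottom_rest_gap:
  assumes "\<sigma> = [] \<or> t \<le> hd \<sigma>"
  shows "bottom_rest (t # \<tau>) \<sigma> =
    t # hat t (top_block \<tau> \<sigma> 0) (bottom_block \<tau> \<sigma> 0) @ bottom_rest \<tau> \<sigma>"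
proof -
  let ?k = "length (gaps \<tau> \<sigma>)"
  let ?f = "\<lambda>j. gap_letter (t # \<tau>) \<sigma> j # hat_block (t # \<tau>) \<sigma> j"
  have "map ?f [1..<Suc (Suc ?k)] = ?f 1 # map (\<lambda>j. ?f (Suc j)) [1..<Suc ?k]"
    by (simp add: upt_conv_Cons map_Suc_upt[symmetric] comp_def del: upt_Suc)
  also have "map (\<lambda>j. ?f (Suc j)) [1..<Suc ?k] = map (\<lambda>j. gap_letter \<tau> \<sigma> j # hat_block \<tau> \<sigma> j) [1..<Suc ?k]"
    by (rule map_cong) (auto simp: hat_block_eq blocks_gap[OF assms] simp del: upt_Suc)
  also have "?f 1 = t # hat t (top_block \<tau> \<sigma> 0) (bottom_block \<tau> \<sigma> 0)"
    using blocks_gap(3,4)[OF assms, of 0 \<tau>] blocks_gap(6)[OF assms] by (simp add: hat_block_eq)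
  finally show ?thesis
    by (simp add: bottom_rest_def blocks_gap[OF assms] gaps_gap[OF assms] del: upt_Suc)
qed

lemma drop_pair_less:
  assumes "s < t"
  shows "drop_pair (t # \<tau>) (s # \<sigma>) = (t # fst (drop_pair \<tau> \<sigma>), s # snd (drop_pair \<tau> \<sigma>))"
proof -
  let ?k = "length (gaps \<tau> \<sigma>)"
  have upt: "[0..<?k + 1] = 0 # [1..<?k + 1]"
    by (simp add: upt_conv_Cons del: upt_Suc)
  have "map (top_block (t # \<tau>) (s # \<sigma>)) [1..<?k + 1] = map (top_block \<tau> \<sigma>) [1..<?k + 1]"
    by (rule map_cong) (auto simp: blocks_less[OF assms] simp del: upt_Suc)
  then show ?thesis
    unfolding drop_pair_eq gaps_less[OF assms] length_map upt bottom_rest_less[OF assms]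
    by (simp only: list.map concat.simps blocks_less[OF assms] fst_conv snd_conv append_Cons)
qed

lemma drop_pair_gap:
  assumes "\<sigma> = [] \<or> t \<le> hd \<sigma>"
  shows "drop_pair (t # \<tau>) \<sigma> = (fst (drop_pair \<tau> \<sigma>),
    t # hat t (top_block \<tau> \<sigma> 0) (bottom_block \<tau> \<sigma> 0) @ bottom_rest \<tau> \<sigma>)"
proof -
  let ?k = "length (gaps \<tau> \<sigma>)"
  have upt: "[0..<Suc ?k + 1] = 0 # map Suc [0..<?k + 1]"
    by (simp add: upt_conv_Cons map_Suc_upt del: upt_Suc)
  have tops: "map (\<lambda>j. top_block (t # \<tau>) \<sigma> (Suc j)) [0..<?k + 1] = map (top_block \<tau> \<sigma>) [0..<?k + 1]"
    by (rule map_cong) (auto simp: blocks_gap[OF assms] simp del: upt_Suc)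
  show ?thesis
    unfolding drop_pair_eq gaps_gap[OF assms] length_map length_Cons upt bottom_rest_gap[OF assms]
      list.map map_map comp_def tops concat.simps blocks_gap(1,2)[OF assms] by simp
qed

lemma drop_pair_Nil: "drop_pair [] \<sigma> = ([], \<sigma>)"
proof -
  have "bottom_tail [] \<sigma> = \<sigma>"
    by (simp add: bottom_tail_def align_cols_Nil)
  then show ?thesis
    by (simp add: drop_pair_def gaps_def top_block_def bottom_block_def block_start_def block_end_def)
qed

lemma top_block_0_cases:
  assumes "top_block \<tau> \<sigma> 0 \<noteq> []"
  obtains t \<tau>' s \<sigma>' where "\<tau> = t # \<tau>'" "\<sigma> = s # \<sigma>'" "s < t"
proof -
  obtain t \<tau>' where \<tau>: "\<tau> = t # \<tau>'"
    using assms by (cases \<tau>) (auto simp: top_block_def block_start_def block_end_def gaps_def)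
  then have "\<not> (\<sigma> = [] \<or> t \<le> hd \<sigma>)"
    using assms blocks_gap(1) by blast
  then show thesis
    using that \<tau> by (cases \<sigma>) auto
qed

section \<open>Agreement of \<open>drop_pair\<close> with row insertion\<close>

text \<open>Inserting \<open>s\<close> acts at the head \<open>t\<close> and leaves \<tau> intact
  behind two letters, so the word in question is a factor of an equivalent reduced word.\<close>

lemma reduced_word_pass:
  assumes "sorted_wrt (<) (t # \<tau>)" "reduced_word ((t # \<tau>) @ s # \<sigma>)" "s \<le> t"
  shows "reduced_word (\<tau> @ \<sigma>)"
proof -
  have "reduced_word ((t # \<tau>) @ [s])"
    using assms(2) reduced_word_factor[of "[]" "(t # \<tau>) @ [s]" \<sigma>] by simp
  then have "reduced_word ([] @ (ins_out (t # \<tau>) s @ ins_row (t # \<tau>) s) @ \<sigma>)"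
    using ck_reduced_word[OF ck_ins[OF assms(1)], of s "[]" \<sigma>] assms(2) by simp
  then obtain x y where "reduced_word ([x, y] @ (\<tau> @ \<sigma>) @ [])"
    using assms(3) by (auto split: if_splits)
  then show ?thesis
    by (rule reduced_word_factor)
qed

lemma drop_pair_word_ins:
  assumes "sorted_wrt (<) \<tau>" "sorted_wrt (<) \<sigma>" "reduced_word (\<tau> @ \<sigma>)"
  shows "drop_pair \<tau> \<sigma> = (word_out \<tau> \<sigma>, word_row \<tau> \<sigma>)"
  using assms
proof (induction \<tau> arbitrary: \<sigma>)
  case Nil
  then show ?case by (simp add: drop_pair_Nil word_out_nil word_row_nil)
next
  case (Cons t \<tau>)
  consider (gap) "\<sigma> = [] \<or> t < hd \<sigma>" | (less) s \<sigma>' where "\<sigma> = s # \<sigma>'" "s < t" | (equal) \<sigma>' where "\<sigma> = t # \<sigma>'"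
    by (metis linorder_neqE_nat list.collapse)
  then show ?case
  proof cases
    case gap
    \<comment> \<open>No shift occurs: the letter of \<sigma> below the first letter of the block
      lies strictly between it and \<open>t\<close>, so that first letter is at least t+2.\<close>
    have "top_block \<tau> \<sigma> 0 = [] \<or> top_block \<tau> \<sigma> 0 ! 0 \<noteq> Suc t"
    proof (cases "top_block \<tau> \<sigma> 0 = []")
      case False
      then show ?thesis
        using gap blocks_less(1) by (auto elim!: top_block_0_cases)
    qed simp
    then have *: "drop_pair (t # \<tau>) \<sigma> = (fst (drop_pair \<tau> \<sigma>), t # snd (drop_pair \<tau> \<sigma>))"
      using drop_pair_gap[of \<sigma> t \<tau>] gap by (auto simp: hat_id drop_pair_eq)
    have "reduced_word (\<tau> @ \<sigma>)"
      using Cons.prems(3) reduced_word_factor[of "[t]" "\<tau> @ \<sigma>" "[]"] by simp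
    then have "drop_pair \<tau> \<sigma> = (word_out \<tau> \<sigma>, word_row \<tau> \<sigma>)"
      using Cons by simp
    then show ?thesis
      using gap Cons.prems(2) unfolding * by (cases \<sigma>) (auto simp: word_ins_Cons)
  next
    case less
    have "reduced_word (\<tau> @ \<sigma>')"
      using Cons.prems less reduced_word_pass[of t \<tau> s \<sigma>'] by simp
    then show ?thesis
      using Cons less by (simp add: drop_pair_less word_ins_Cons)
  next
    case equal
    have red: "reduced_word (\<tau> @ \<sigma>')"
      using Cons.prems equal reduced_word_pass[of t \<tau> t \<sigma>'] by simp
    \<comment> \<open>Reducedness makes \<open>Suc t\<close> the next letter of the top row. In the
      alignment \<open>t\<close> is thus a gap, and the \<open>t\<close> of the lower row stands
      below \<open>Suc t\<close>.\<close>
    have "Suc t \<in> set (t # \<tau>)"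
      using reduced_word_row_repeated[of "t # \<tau>" t] Cons.prems(1,3)
        reduced_word_factor[of "[]" "t # \<tau> @ [t]" \<sigma>'] by (simp add: equal)
    then obtain \<tau>' where \<tau>: "\<tau> = Suc t # \<tau>'"
      using Cons.prems(1) by (cases \<tau>) (auto dest: Suc_leI leD)
    have gap: "\<sigma>' = [] \<or> Suc t \<le> hd \<sigma>'"
      using Cons.prems(2) by (cases \<sigma>') (auto simp: equal)
    \<comment> \<open>The shift raises that lower \<open>t\<close> to \<open>Suc t\<close>, which is
      the head of the row that insertion leaves in \<tau>; the remaining shift is the one belonging
      to the gap \<open>Suc t\<close> of the pair \<tau>, \<open>\<sigma>'\<close>.\<close>
    have hat: "hat t (Suc t # top_block \<tau>' \<sigma>' 0) (t # bottom_block \<tau>' \<sigma>' 0) =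
        Suc t # hat (Suc t) (top_block \<tau>' \<sigma>' 0) (bottom_block \<tau>' \<sigma>' 0)"
    proof (rule hat_Cons)
      assume "top_block \<tau>' \<sigma>' 0 \<noteq> []"
      then show "bottom_block \<tau>' \<sigma>' 0 \<noteq> [] \<and> t < bottom_block \<tau>' \<sigma>' 0 ! 0 \<and>
          bottom_block \<tau>' \<sigma>' 0 ! 0 < top_block \<tau>' \<sigma>' 0 ! 0"
        using gap blocks_less(1,2) by (auto elim!: top_block_0_cases)
    qed
    have "drop_pair \<tau> \<sigma>' = (word_out \<tau> \<sigma>', word_row \<tau> \<sigma>')"
      using Cons red by (simp add: equal)
    moreover have "drop_pair (t # \<tau>) (t # \<sigma>') = (Suc t # fst (drop_pair \<tau> \<sigma>'), t # snd (drop_pair \<tau> \<sigma>'))"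
      using drop_pair_gap[of "t # \<sigma>'" t \<tau>] drop_pair_gap[OF gap, of \<tau>']
        drop_pair_less[of t "Suc t" \<tau>' \<sigma>'] blocks_less(1,2)[of t "Suc t" \<tau>' \<sigma>'] bottom_rest_less[of t "Suc t" \<tau>' \<sigma>'] hat
      unfolding \<tau> by simp
    ultimately show ?thesis
      using Cons.prems(2) by (simp add: equal word_ins_Cons)
  qed
qed


section \<open>The operators on row sequences and their relations\<close>

lemma row_seqs_appendD:
  assumes "P @ U @ Q \<in> row_seqs m"
  shows "\<forall>w\<in>set U. sorted_wrt (<) w" "reduced_word (concat (rev U))"
  using assms reduced_word_factor[of "concat (rev Q)" "concat (rev U)" "concat (rev P)"]
  by (auto simp: row_seqs_def)

lemma drop_row_row_seqs:
  assumes "P @ \<sigma> # \<tau> # Q \<in> row_seqs m"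
  shows "drop_row (Suc (length P)) (P @ \<sigma> # \<tau> # Q) = P @ word_row \<tau> \<sigma> # word_out \<tau> \<sigma> # Q"
    and "P @ word_row \<tau> \<sigma> # word_out \<tau> \<sigma> # Q \<in> row_seqs m"
proof -
  have sorted: "sorted_wrt (<) \<sigma>" "sorted_wrt (<) \<tau>" and red: "reduced_word (\<tau> @ \<sigma>)"
    using row_seqs_appendD[of P "[\<sigma>, \<tau>]" Q] assms by simp_all
  show "drop_row (Suc (length P)) (P @ \<sigma> # \<tau> # Q) = P @ word_row \<tau> \<sigma> # word_out \<tau> \<sigma> # Q"
    using drop_pair_word_ins[OF sorted(2,1) red] by (simp add: drop_row_def nth_append list_update_append)
  have "reduced_word (concat (rev Q) @ (\<tau> @ \<sigma>) @ concat (rev P))"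
    using assms by (simp add: row_seqs_def)
  then have "reduced_word (concat (rev Q) @ (word_out \<tau> \<sigma> @ word_row \<tau> \<sigma>) @ concat (rev P))"
    by (rule ck_reduced_word[OF ck_word_ins[OF sorted(2) red]])
  then show "P @ word_row \<tau> \<sigma> # word_out \<tau> \<sigma> # Q \<in> row_seqs m"
    using assms sorted_word_row[OF sorted(2)] sorted_word_out[OF sorted(2,1)] by (auto simp: row_seqs_def)
qed

lemma split_rows:
  assumes "1 \<le> i" "i < length \<rho>"
  obtains P \<sigma> \<tau> Q where "\<rho> = P @ \<sigma> # \<tau> # Q" "i = Suc (length P)"
proof
  have "Suc (i - 1) = i"
    using assms by simp
  then have "drop (i - 1) \<rho> = \<rho> ! (i - 1) # \<rho> ! i # drop (Suc i) \<rho>"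
    using assms by (metis Cons_nth_drop_Suc Suc_lessD)
  then show "\<rho> = take (i - 1) \<rho> @ \<rho> ! (i - 1) # \<rho> ! i # drop (Suc i) \<rho>"
    by (metis append_take_drop_id)
  show "i = Suc (length (take (i - 1) \<rho>))"
    using assms by simp
qed

lemma drop_row_in_row_seqs:
  assumes "\<rho> \<in> row_seqs m" "1 \<le> i" "i < m"
  shows "drop_row i \<rho> \<in> row_seqs m"
proof -
  have "i < length \<rho>"
    using assms by (simp add: row_seqs_def)
  with assms(2) obtain P \<sigma> \<tau> Q where "\<rho> = P @ \<sigma> # \<tau> # Q" "i = Suc (length P)"
    by (rule split_rows)
  then show ?thesis
    using drop_row_row_seqs assms(1) by metis
qed

lemma drop_row_idem:
  assumes "\<rho> \<in> row_seqs m" "1 \<le> i" "i < m"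
  shows "drop_row i (drop_row i \<rho>) = drop_row i \<rho>"
proof -
  have "i < length \<rho>"
    using assms by (simp add: row_seqs_def)
  with assms(2) obtain P \<sigma> \<tau> Q where \<rho>: "\<rho> = P @ \<sigma> # \<tau> # Q" and i: "i = Suc (length P)"
    by (rule split_rows)
  have sorted: "sorted_wrt (<) \<sigma>" "sorted_wrt (<) \<tau>"
    using row_seqs_appendD(1)[of P "[\<sigma>, \<tau>]" Q] assms(1) by (simp_all add: \<rho>)
  note step = drop_row_row_seqs[OF assms(1)[unfolded \<rho>]]
  show ?thesis
    unfolding \<rho> i step(1) drop_row_row_seqs(1)[OF step(2)]
    using tableau_ins[OF tableau_word_ins] sorted sorted_word_row by simp
qed

lemma drop_row_commute:
  assumes \<rho>: "\<rho> \<in> row_seqs m" and ij: "1 \<le> i" "i + 1 < j" "j < m"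
  shows "drop_row i (drop_row j \<rho>) = drop_row j (drop_row i \<rho>)"
proof -
  have len: "length \<rho> = m"
    using \<rho> by (simp add: row_seqs_def)
  then have "i < length \<rho>"
    using ij by simp
  with ij(1) obtain P \<sigma> \<tau> Q where P: "\<rho> = P @ \<sigma> # \<tau> # Q" "i = Suc (length P)"
    by (rule split_rows)
  have "1 \<le> j - i - 1" "j - i - 1 < length Q"
    using P ij len by auto
  then obtain P' \<sigma>' \<tau>' Q' where Q: "Q = P' @ \<sigma>' # \<tau>' # Q'" "j - i - 1 = Suc (length P')"
    by (rule split_rows)
  \<comment> \<open>Stated for arbitrary rows \<open>x\<close> and \<open>y\<close>, since the step
    at \<open>j\<close> is needed both before and after rows i and i+1 have been replaced.\<close>
  have j: "j = Suc (length (P @ x # y # P'))" for x y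
    using P Q ij by simp
  have i_step: "P @ u # v # R \<in> row_seqs m \<Longrightarrow>
      drop_row i (P @ u # v # R) = P @ word_row v u # word_out v u # R \<and>
      P @ word_row v u # word_out v u # R \<in> row_seqs m" for u v R
    using drop_row_row_seqs P(2) by blast
  have j_step: "P @ x # y # P' @ \<sigma>' # \<tau>' # Q' \<in> row_seqs m \<Longrightarrow>
      drop_row j (P @ x # y # P' @ \<sigma>' # \<tau>' # Q') =
        P @ x # y # P' @ word_row \<tau>' \<sigma>' # word_out \<tau>' \<sigma>' # Q' \<and>
      P @ x # y # P' @ word_row \<tau>' \<sigma>' # word_out \<tau>' \<sigma>' # Q' \<in> row_seqs m" for x y
    using drop_row_row_seqs[of "P @ x # y # P'" \<sigma>' \<tau>' Q' m] unfolding j[of x y] by simp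
  show ?thesis
    using \<rho> i_step j_step unfolding P(1) Q(1) by metis
qed

lemma drop_row_braid:
  assumes \<rho>: "\<rho> \<in> row_seqs m" and i: "1 \<le> i" "i + 1 < m"
  shows "drop_row i (drop_row (i + 1) (drop_row i \<rho>)) = drop_row (i + 1) (drop_row i (drop_row (i + 1) \<rho>))"
proof -
  have "i < length \<rho>"
    using assms by (simp add: row_seqs_def)
  \<comment> \<open>Rows are stored from the bottom up, so the three rows A|B|C appear in the list
    in the order \<open>C\<close>, \<open>B\<close>, \<open>A\<close>.\<close>
  with i(1) obtain P C B R where P: "\<rho> = P @ C # B # R" "i = Suc (length P)"
    by (rule split_rows)
  have "R \<noteq> []"
    using assms P by (auto simp: row_seqs_def)
  then obtain A Q where R: "R = A # Q"
    by (cases R) auto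
  have low: "drop_row i (P @ x # y # z # Q) = P @ word_row y x # word_out y x # z # Q"
      "P @ word_row y x # word_out y x # z # Q \<in> row_seqs m"
    if "P @ x # y # z # Q \<in> row_seqs m" for x y z
    using drop_row_row_seqs[of P x y "z # Q"] that P(2) by blast+
  have high: "drop_row (i + 1) (P @ x # y # z # Q) = P @ x # word_row z y # word_out z y # Q"
      "P @ x # word_row z y # word_out z y # Q \<in> row_seqs m"
    if "P @ x # y # z # Q \<in> row_seqs m" for x y z
    using drop_row_row_seqs[of "P @ [x]" y z Q] that P(2) by simp_all
  have mem: "P @ C # B # A # Q \<in> row_seqs m"
    using \<rho> P(1) R by simp
  have rows: "sorted_wrt (<) A" "sorted_wrt (<) B" "sorted_wrt (<) C" "reduced_word (A @ B @ C)"
    using row_seqs_appendD[of P "[C, B, A]" Q] mem by simp_all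
  note l1 = low[OF mem] note l2 = high[OF l1(2)] note l3 = low(1)[OF l2(2)]
  note r1 = high[OF mem] note r2 = low[OF r1(2)] note r3 = high(1)[OF r2(2)]
  show ?thesis
    unfolding P(1) R l1(1) l2(1) l3 r1(1) r2(1) r3
    using word_ins_braid[OF rows refl refl refl refl refl refl refl refl refl refl] by simp
qed

theorem theorem4p8:
  fixes m :: nat
  assumes "m \<ge> 2"
  shows "(\<forall>i. 1 \<le> i \<and> i < m \<longrightarrow> drop_row i \<in> row_seqs m \<rightarrow> row_seqs m) \<and>
    (\<forall>i. 1 \<le> i \<and> i < m \<longrightarrow>
           (\<forall>\<rho>\<in>row_seqs m. drop_row i (drop_row i \<rho>) = drop_row i \<rho>)) \<and>
    (\<forall>i j. 1 \<le> i \<and> i < m \<and> 1 \<le> j \<and> j < m \<and> \<bar>int i - int j\<bar> > 1 \<longrightarrow>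
           (\<forall>\<rho>\<in>row_seqs m. drop_row i (drop_row j \<rho>) = drop_row j (drop_row i \<rho>))) \<and>
    (\<forall>i. 1 \<le> i \<and> i + 1 < m \<longrightarrow>
           (\<forall>\<rho>\<in>row_seqs m.
              drop_row i (drop_row (i + 1) (drop_row i \<rho>)) =
              drop_row (i + 1) (drop_row i (drop_row (i + 1) \<rho>))))"
proof (intro conjI allI impI ballI)
  fix i j \<rho>
  assume ij: "1 \<le> i \<and> i < m \<and> 1 \<le> j \<and> j < m \<and> \<bar>int i - int j\<bar> > 1" and "\<rho> \<in> row_seqs m"
  then show "drop_row i (drop_row j \<rho>) = drop_row j (drop_row i \<rho>)"
    using drop_row_commute[of \<rho> m i j] drop_row_commute[of \<rho> m j i] by (cases "i < j") auto
qed (use drop_row_in_row_seqs drop_row_idem drop_row_braid in \<open>auto\<close>)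

end
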